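(* If $f:X\to Y$ is a subproper map from a metrizable space $X$ onto a submetrizable sequentially Prohorov Tychonoff space $Y$, then the map $P_r(f):P_r(X)\to P_r(Y)$ is subproper.
   Context: All topological spaces are Hausdorff; "map" means continuous function. A subset is precompact if its closure is compact. A map $f:X\to Y$ is subproper if there is $Z\subset X$ with $f(Z)=Y$ such that $Z\cap f^{-1}(K)$ is precompact in $X$ for every precompact $K\subset Y$. A space is submetrizable if it admits a continuous bijective map onto a metrizable space. A Borel probability measure $\mu$ on $X$ is Radon if for every $\varepsilon>0$ and every Borel $B\subset X$ there is a compact $K\subset B$ with $\mu(B\setminus K)<\varepsilon$. $P_r(X)$ is the space of all Radon Borel probability measures on $X$ with the topology generated by the sub-basis of sets $\{\mu\in P_r(X):\mu(U)>a\}$, $a\in\mathbb R$, $U\subset X$ open. $P_r(f)(\mu)(B)=\mu(f^{-1}(B))$ for Borel $B\subset Y$. A family $\mathcal M\subset P_r(X)$ is uniformly tight if for every $\varepsilon>0$ there is a compact $K_\varepsilon\subset X$ with $\mu(X\setminus K_\varepsilon)<\varepsilon$ for all $\mu\in\mathcal M$. A Tychonoff space $X$ is sequentially Prohorov if each convergent sequence in $P_r(X)$ is uniformly tight. *)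

theory Defs
  imports "HOL-Probability.Probability"
begin

section \<open>Subproper maps, Tychonoff and submetrizable spaces\<close>

definition precompact_in :: "'a topology \<Rightarrow> 'a set \<Rightarrow> bool" where
  "precompact_in X S \<longleftrightarrow> S \<subseteq> topspace X \<and> compactin X (X closure_of S)"

definition subproper_map :: "'a topology \<Rightarrow> 'b topology \<Rightarrow> ('a \<Rightarrow> 'b) \<Rightarrow> bool" where
  "subproper_map X Y f \<longleftrightarrow> continuous_map X Y f \<and>
     (\<exists>Z \<subseteq> topspace X. f ` Z = topspace Y \<and>
        (\<forall>K. precompact_in Y K \<longrightarrow> precompact_in X (Z \<inter> f -` K)))"

text \<open>The library's \<^const>\<open>completely_regular_space\<close> does not include the Hausdorff property.\<close>

definition Tychonoff_space :: "'a topology \<Rightarrow> bool" where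
  "Tychonoff_space X \<longleftrightarrow> completely_regular_space X \<and> Hausdorff_space X"

text \<open>A metrizable space in continuous bijection with \<open>X\<close> can be transported along that
  bijection to the point set of \<open>X\<close>, so it is no restriction to take it over the same type;
  see \<open>submetrizable_spaceI\<close>.\<close>

definition submetrizable_space :: "'a topology \<Rightarrow> bool" where
  "submetrizable_space X \<longleftrightarrow>
     (\<exists>(M :: 'a topology) g. metrizable_space M \<and> continuous_map X M g \<and>
        bij_betw g (topspace X) (topspace M))"

lemma submetrizable_spaceI:
  fixes X :: "'a topology" and M :: "'c topology"
  assumes M: "metrizable_space M" and g: "continuous_map X M g"
    and bij: "bij_betw g (topspace X) (topspace M)"
  shows "submetrizable_space X"
proof -
  define h where "h = inv_into (topspace X) g"
  define N where "N = pullback_topology (topspace X) g M"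
  have img: "g ` topspace X = topspace M"
    using bij by (simp add: bij_betw_def)
  have topN: "topspace N = topspace X"
    using img by (auto simp: N_def topspace_pullback_topology)
  have hg: "h (g x) = x" if "x \<in> topspace X" for x
    using that bij by (simp add: h_def bij_betw_inv_into_left)
  have gh: "g (h y) = y" if "y \<in> topspace M" for y
    using that bij by (simp add: h_def bij_betw_inv_into_right)
  have h_in: "h y \<in> topspace X" if "y \<in> topspace M" for y
    using that img by (simp add: h_def inv_into_into)
  have cN: "continuous_map N M g"
    unfolding N_def using continuous_map_pullback[of M M id "topspace X" g]
    by (simp add: o_def)
  have cM: "continuous_map M N h"
    unfolding N_def
  proof (rule continuous_map_pullback')
    show "continuous_map M M (g \<circ> h)"
      by (rule continuous_map_eq[OF continuous_map_id]) (simp add: gh)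
    show "topspace M \<subseteq> h -` topspace X"
      using h_in by auto
  qed
  have "homeomorphic_maps N M g h"
    unfolding homeomorphic_maps_def using cN cM hg gh topN by simp
  then have N: "metrizable_space N"
    using M homeomorphic_metrizable_space homeomorphic_space_def by blast
  have "continuous_map X N id"
    unfolding N_def by (rule continuous_map_pullback') (use g in auto)
  then show ?thesis
    unfolding submetrizable_space_def using N topN by (metis bij_betw_id)
qed


section \<open>Spaces of Radon probability measures\<close>

definition borel_of :: "'a topology \<Rightarrow> 'a measure" where
  "borel_of X = sigma (topspace X) {U. openin X U}"

text \<open>Compact subsets of a Hausdorff space are closed, so \<open>B - K\<close> below is a Borel set for all
  spaces of interest.\<close>

definition Radon_prob :: "'a topology \<Rightarrow> 'a measure set" where
  "Radon_prob X = {\<mu>. prob_space \<mu> \<and> sets \<mu> = sets (borel_of X) \<and>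
     (\<forall>\<epsilon>>0. \<forall>B \<in> sets (borel_of X). \<exists>K. compactin X K \<and> K \<subseteq> B \<and> measure \<mu> (B - K) < \<epsilon>)}"

definition Radon_topology :: "'a topology \<Rightarrow> 'a measure topology" where
  "Radon_topology X =
     topology_generated_by {{\<mu> \<in> Radon_prob X. measure \<mu> U > a} | (a :: real) U. openin X U}"

lemma topspace_Radon_topology [simp]: "topspace (Radon_topology X) = Radon_prob X"
proof -
  have "\<mu> \<in> Radon_prob X \<Longrightarrow> measure \<mu> {} > -1" for \<mu>
    by simp
  then show ?thesis
    unfolding Radon_topology_def topology_generated_by_topspace
    using openin_empty[of X] by blast
qed

definition Radon_map :: "'b topology \<Rightarrow> ('a \<Rightarrow> 'b) \<Rightarrow> 'a measure \<Rightarrow> 'b measure" where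
  "Radon_map Y f \<mu> = distr \<mu> (borel_of Y) f"

definition uniformly_tight :: "'a topology \<Rightarrow> 'a measure set \<Rightarrow> bool" where
  "uniformly_tight X \<M> \<longleftrightarrow>
     (\<forall>\<epsilon>>0. \<exists>K. compactin X K \<and> (\<forall>\<mu>\<in>\<M>. measure \<mu> (topspace X - K) < \<epsilon>))"

text \<open>\<^const>\<open>limitin\<close> constrains only a tail of the sequence, so that all terms lie in the
  space is required separately.\<close>

definition sequentially_Prohorov_space :: "'a topology \<Rightarrow> bool" where
  "sequentially_Prohorov_space X \<longleftrightarrow> Tychonoff_space X \<and>
     (\<forall>\<sigma> \<mu>. range \<sigma> \<subseteq> Radon_prob X \<and> limitin (Radon_topology X) \<sigma> \<mu> sequentially
        \<longrightarrow> uniformly_tight X (range \<sigma>))"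

end

theory Submission
  imports Defs
begin

text \<open>
  Let \<open>Z\<close> be a set that witnesses that \<open>f\<close> is subproper, and let \<open>s\<close> be any section of \<open>f\<close> with
  values in \<open>Z\<close>. If \<open>K\<close> is compact in \<open>Y\<close>, then \<open>s ` K\<close> has compact closure, and \<open>f\<close> maps this closure
  into \<open>K\<close>. If \<open>s\<close> were measurable, a section of \<open>Radon_map Y f\<close> would be given by taking images of
  measures under \<open>s\<close>. In general \<open>s\<close> is not measurable, but only one property of the image measures
  is used: for every \<open>\<mu>\<close> there is a Radon measure \<open>S \<mu>\<close> on \<open>X\<close> such that the closure of \<open>s ` K\<close> has
  \<open>S \<mu>\<close>-measure at least \<open>\<mu>(K)\<close>, for all compact \<open>K\<close> at once (\<open>Radon_lift_along_section\<close>). It follows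
  that the image of \<open>S \<mu>\<close> under \<open>f\<close> is at least \<open>\<mu>\<close> on compact sets, hence equal to \<open>\<mu>\<close>
  (\<open>Radon_prob_eqI\<close>). The range of \<open>S\<close> is the set that witnesses subproperness.

  It remains to see that \<open>S\<close> maps a precompact set \<open>\<K>\<close> to a precompact set. Such a \<open>\<K>\<close> need not be
  uniformly tight, so one has to argue with sequences. Since \<open>Y\<close> is submetrizable, a continuous
  injection into a metrizable space induces one on the Radon measures, the closure of \<open>\<K>\<close> is
  metrizable, and each sequence in \<open>\<K>\<close> has a convergent subsequence. The latter is uniformly tight
  because \<open>Y\<close> is sequentially Prohorov. The bounds for \<open>S\<close> transfer uniform tightness to the sequence
  of lifts, which therefore has a convergent subsequence
  (\<open>uniformly_tight_imp_convergent_subsequence\<close>). The space of Radon measures on \<open>X\<close> is metrizable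
  by the Levy-Prohorov metric (\<open>metrizable_space_Radon_topology\<close>), so the convergence of
  subsequences means that the closure of the set of lifts is compact.

  Both constructions of measures on \<open>X\<close>, the lift and the limit of a tight sequence, are carried
  out on the real line. Any \<open>\<sigma>\<close>-compact subset of \<open>X\<close> is the image of a closed set of reals under a
  continuous map with a Borel right inverse (\<open>coding_of_sigma_compact\<close>). On the line the order is
  available: the limit comes from Helly's selection theorem, and the lift from a least measurable
  majorant (\<open>measurable_selection_of_arbitrary_function\<close>).
\<close>

section \<open>Radon measures and their images\<close>

lemma space_borel_of [simp]: "space (borel_of X) = topspace X"
  unfolding borel_of_def by (rule space_measure_of) (auto dest: openin_subset)

lemma sets_borel_of: "sets (borel_of X) = sigma_sets (topspace X) {U. openin X U}"
  unfolding borel_of_def by (rule sets_measure_of) (auto dest: openin_subset)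

lemma openin_imp_borel_of: "openin X U \<Longrightarrow> U \<in> sets (borel_of X)"
  by (simp add: sets_borel_of sigma_sets.Basic)

lemma closedin_imp_borel_of:
  assumes "closedin X C" shows "C \<in> sets (borel_of X)"
proof -
  have "topspace X - (topspace X - C) = C"
    using assms closedin_subset by blast
  then show ?thesis
    using sets.compl_sets[OF openin_imp_borel_of[of X "topspace X - C"]] assms
    by (simp add: openin_diff)
qed

lemma compactin_imp_borel_of:
  "Hausdorff_space X \<Longrightarrow> compactin X K \<Longrightarrow> K \<in> sets (borel_of X)"
  by (simp add: closedin_imp_borel_of compactin_imp_closedin)

lemma measurable_borel_ofI:
  assumes "f \<in> space M \<rightarrow> topspace X"
    and "\<And>U. openin X U \<Longrightarrow> f -` U \<inter> space M \<in> sets M"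
  shows "f \<in> measurable M (borel_of X)"
  unfolding borel_of_def by (rule measurable_measure_of) (use assms in \<open>auto dest: openin_subset\<close>)

lemma continuous_map_borel_measurable:
  assumes "continuous_map X Y f"
  shows "f \<in> measurable (borel_of X) (borel_of Y)"
proof (rule measurable_borel_ofI)
  show "f \<in> space (borel_of X) \<rightarrow> topspace Y"
    using assms by (simp add: continuous_map_def)
  show "f -` U \<inter> space (borel_of X) \<in> sets (borel_of X)" if "openin Y U" for U
  proof -
    have "f -` U \<inter> topspace X = {x \<in> topspace X. f x \<in> U}" by auto
    then show ?thesis
      using assms that by (simp add: openin_imp_borel_of continuous_map_def)
  qed
qed

lemma Radon_probD:
  assumes "\<mu> \<in> Radon_prob X"
  shows "prob_space \<mu>" "sets \<mu> = sets (borel_of X)" "space \<mu> = topspace X"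
proof -
  show p: "prob_space \<mu>" "sets \<mu> = sets (borel_of X)"
    using assms by (auto simp: Radon_prob_def)
  show "space \<mu> = topspace X"
    using sets_eq_imp_space_eq[OF p(2)] by simp
qed

lemma Radon_prob_inner:
  assumes "\<mu> \<in> Radon_prob X" "B \<in> sets (borel_of X)" "\<epsilon> > 0"
  obtains K where "compactin X K" "K \<subseteq> B" "measure \<mu> (B - K) < \<epsilon>"
  using assms unfolding Radon_prob_def by blast

text \<open>An inequality on compact sets passes to all Borel sets by inner regularity. Two probability
  measures one of which dominates the other are equal, since the inequality can be applied to
  complements as well.\<close>
lemma Radon_prob_eqI:
  assumes H: "Hausdorff_space Y" and \<mu>: "\<mu> \<in> Radon_prob Y" and \<nu>: "\<nu> \<in> Radon_prob Y"
    and le: "\<And>K. compactin Y K \<Longrightarrow> measure \<mu> K \<le> measure \<nu> K"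
  shows "\<mu> = \<nu>"
proof -
  interpret M: prob_space \<mu> using Radon_probD[OF \<mu>] by simp
  interpret N: prob_space \<nu> using Radon_probD[OF \<nu>] by simp
  note s = Radon_probD(2,3)[OF \<mu>] Radon_probD(2,3)[OF \<nu>]
  have leB: "measure \<mu> B \<le> measure \<nu> B" if B: "B \<in> sets (borel_of Y)" for B
  proof (rule field_le_epsilon)
    fix e :: real assume "e > 0"
    then obtain K where K: "compactin Y K" "K \<subseteq> B" "measure \<mu> (B - K) < e"
      using Radon_prob_inner[OF \<mu> B] by metis
    have Km: "K \<in> sets (borel_of Y)" using H K(1) by (rule compactin_imp_borel_of)
    have "measure \<mu> B = measure \<mu> K + measure \<mu> (B - K)"
      using M.finite_measure_Diff[of B K] B Km K(2) s by simp
    also have "\<dots> \<le> measure \<nu> B + e"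
      using le[OF K(1)] N.finite_measure_mono[OF K(2)] B s K(3) by simp
    finally show "measure \<mu> B \<le> measure \<nu> B + e" .
  qed
  have eqB: "measure \<mu> B = measure \<nu> B" if B: "B \<in> sets (borel_of Y)" for B
  proof -
    have "measure \<mu> (topspace Y - B) \<le> measure \<nu> (topspace Y - B)"
      using leB sets.compl_sets[OF B] by simp
    then show ?thesis
      using leB[OF B] M.prob_compl[of B] N.prob_compl[of B] B s by simp
  qed
  show ?thesis
  proof (rule measure_eqI)
    show "sets \<mu> = sets \<nu>" using s by simp
    show "emeasure \<mu> A = emeasure \<nu> A" if "A \<in> sets \<mu>" for A
      using eqB[of A] that s by (simp add: M.emeasure_eq_measure N.emeasure_eq_measure)
  qed
qed

lemma measure_Radon_map:
  assumes "continuous_map X Y f" "\<mu> \<in> Radon_prob X" "B \<in> sets (borel_of Y)"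
  shows "measure (Radon_map Y f \<mu>) B = measure \<mu> (f -` B \<inter> topspace X)"
proof -
  have "f \<in> measurable \<mu> (borel_of Y)"
    using continuous_map_borel_measurable[OF assms(1)]
      measurable_cong_sets[OF Radon_probD(2)[OF assms(2)] refl] by blast
  then show ?thesis
    unfolding Radon_map_def
    using measure_distr[of f \<mu> "borel_of Y" B] assms Radon_probD(3)[OF assms(2)] by simp
qed

lemma Radon_map_in_Radon_prob:
  assumes HX: "Hausdorff_space X" and H: "Hausdorff_space Y"
    and f: "continuous_map X Y f" and \<mu>: "\<mu> \<in> Radon_prob X"
  shows "Radon_map Y f \<mu> \<in> Radon_prob Y"
proof -
  interpret M: prob_space \<mu> using Radon_probD[OF \<mu>] by simp
  note s = Radon_probD(2,3)[OF \<mu>]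
  have fm: "f \<in> measurable \<mu> (borel_of Y)"
    using continuous_map_borel_measurable[OF f] measurable_cong_sets[OF s(1) refl] by blast
  have "\<exists>K. compactin Y K \<and> K \<subseteq> B \<and> measure (Radon_map Y f \<mu>) (B - K) < \<epsilon>"
    if "\<epsilon> > 0" and B: "B \<in> sets (borel_of Y)" for \<epsilon> B
  proof -
    have fB: "f -` B \<inter> topspace X \<in> sets (borel_of X)"
      using measurable_sets[OF fm B] s by simp
    obtain K where K: "compactin X K" "K \<subseteq> f -` B \<inter> topspace X"
      "measure \<mu> (f -` B \<inter> topspace X - K) < \<epsilon>"
      using Radon_prob_inner[OF \<mu> fB \<open>\<epsilon> > 0\<close>] by metis
    have fK: "compactin Y (f ` K)" using image_compactin[OF K(1) f] .
    have fKm: "f ` K \<in> sets (borel_of Y)" using compactin_imp_borel_of[OF H fK] .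
    have "measure (Radon_map Y f \<mu>) (B - f ` K)
        = measure \<mu> (f -` (B - f ` K) \<inter> topspace X)"
      using measure_Radon_map[OF f \<mu>] B fKm by blast
    also have "\<dots> \<le> measure \<mu> (f -` B \<inter> topspace X - K)"
      by (rule M.finite_measure_mono)
        (use fB compactin_imp_borel_of[OF HX K(1)] s in auto)
    finally show ?thesis using fK K(2,3) by force
  qed
  then show ?thesis
    unfolding Radon_prob_def
    using M.prob_space_distr[OF fm] by (auto simp: Radon_map_def)
qed

section \<open>The topology of the space of Radon measures\<close>

lemma openin_Radon_topology:
  assumes "openin X U"
  shows "openin (Radon_topology X) {\<mu> \<in> Radon_prob X. measure \<mu> U > a}"
  unfolding Radon_topology_def by (rule topology_generated_by_Basis) (use assms in blast)

lemma limitin_Radon_topologyI: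
  assumes \<mu>: "\<mu> \<in> Radon_prob X" and ev: "eventually (\<lambda>n. \<sigma> n \<in> Radon_prob X) F"
    and lim: "\<And>U a. openin X U \<Longrightarrow> a < measure \<mu> U \<Longrightarrow> eventually (\<lambda>n. a < measure (\<sigma> n) U) F"
  shows "limitin (Radon_topology X) \<sigma> \<mu> F"
proof -
  have "\<mu> \<in> W \<longrightarrow> eventually (\<lambda>n. \<sigma> n \<in> W) F"
    if "generate_topology_on {{\<mu> \<in> Radon_prob X. measure \<mu> U > a} | (a :: real) U. openin X U} W" for W
    using that
  proof induction
    case (Basis s)
    then obtain a U where s: "s = {\<mu> \<in> Radon_prob X. measure \<mu> U > a}" "openin X U" by blast
    show ?case
      using eventually_conj[OF ev lim[OF s(2), of a]] by (auto simp: s(1))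
  next
    case (UN K)
    show ?case
    proof
      assume "\<mu> \<in> \<Union> K"
      then obtain k where "k \<in> K" "eventually (\<lambda>n. \<sigma> n \<in> k) F" using UN by blast
      then show "eventually (\<lambda>n. \<sigma> n \<in> \<Union> K) F"
        by (auto elim!: eventually_mono)
    qed
  qed (auto intro: eventually_conj)
  then show ?thesis
    using \<mu> unfolding limitin_def topspace_Radon_topology
    unfolding Radon_topology_def openin_topology_generated_by_iff by simp
qed

lemma continuous_map_into_Radon_topology:
  assumes "\<And>\<nu>. \<nu> \<in> topspace T \<Longrightarrow> F \<nu> \<in> Radon_prob Y"
    and "\<And>U a. openin Y U \<Longrightarrow> openin T {\<nu> \<in> topspace T. a < measure (F \<nu>) U}"
  shows "continuous_map T (Radon_topology Y) F"
  unfolding Radon_topology_def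
proof (rule continuous_on_generated_topo)
  fix W assume "W \<in> {{\<mu> \<in> Radon_prob Y. measure \<mu> U > a} | (a :: real) U. openin Y U}"
  then obtain a U where W: "W = {\<mu> \<in> Radon_prob Y. measure \<mu> U > a}" "openin Y U" by blast
  have "F -` W \<inter> topspace T = {\<nu> \<in> topspace T. a < measure (F \<nu>) U}"
    using assms(1) by (auto simp: W(1))
  then show "openin T (F -` W \<inter> topspace T)"
    using assms(2)[OF W(2)] by simp
next
  have "Radon_prob Y = topspace (Radon_topology Y)" by simp
  then show "F ` topspace T \<subseteq> \<Union> {{\<mu> \<in> Radon_prob Y. measure \<mu> U > a} | (a :: real) U. openin Y U}"
    using assms(1) unfolding Radon_topology_def topology_generated_by_topspace by blast
qed

lemma continuous_map_Radon_map:
  assumes HX: "Hausdorff_space X" and HY: "Hausdorff_space Y" and f: "continuous_map X Y f"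
  shows "continuous_map (Radon_topology X) (Radon_topology Y) (Radon_map Y f)"
proof (rule continuous_map_into_Radon_topology)
  fix U and a :: real assume U: "openin Y U"
  have "{\<nu> \<in> topspace (Radon_topology X). a < measure (Radon_map Y f \<nu>) U}
      = {\<nu> \<in> Radon_prob X. a < measure \<nu> {x \<in> topspace X. f x \<in> U}}"
    using measure_Radon_map[OF f _ openin_imp_borel_of[OF U]]
    by (auto simp: vimage_def Int_def conj_commute)
  then show "openin (Radon_topology X) {\<nu> \<in> topspace (Radon_topology X). a < measure (Radon_map Y f \<nu>) U}"
    using openin_Radon_topology openin_continuous_map_preimage[OF f U] by simp
qed (use Radon_map_in_Radon_prob[OF HX HY f] in simp)

text \<open>A continuous injection maps a compact set onto a compact set, which is Borel in the
  Hausdorff target and has the original set as its preimage. So the image measure determines the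
  values on compact sets, and these determine a Radon measure.\<close>
lemma inj_on_Radon_map:
  assumes HX: "Hausdorff_space X" and HY: "Hausdorff_space Y"
    and f: "continuous_map X Y f" and inj: "inj_on f (topspace X)"
  shows "inj_on (Radon_map Y f) (Radon_prob X)"
proof (rule inj_onI)
  fix \<mu> \<nu> assume \<mu>: "\<mu> \<in> Radon_prob X" and \<nu>: "\<nu> \<in> Radon_prob X"
    and eq: "Radon_map Y f \<mu> = Radon_map Y f \<nu>"
  show "\<mu> = \<nu>"
  proof (rule Radon_prob_eqI[OF HX \<mu> \<nu>])
    fix K assume K: "compactin X K"
    have m: "f ` K \<in> sets (borel_of Y)"
      using compactin_imp_borel_of[OF HY image_compactin[OF K f]] .
    have "f -` (f ` K) \<inter> topspace X = K"
      using inj compactin_subset_topspace[OF K] by (auto simp: inj_on_def)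
    then show "measure \<mu> K \<le> measure \<nu> K"
      using measure_Radon_map[OF f \<mu> m] measure_Radon_map[OF f \<nu> m] eq by simp
  qed
qed

section \<open>The Levy-Prohorov metric\<close>

context Metric_space
begin

definition thicken :: "real \<Rightarrow> 'a set \<Rightarrow> 'a set" where
  "thicken \<epsilon> A = (\<Union>a\<in>A. mball a \<epsilon>)"

lemma openin_thicken: "openin mtopology (thicken \<epsilon> A)"
  unfolding thicken_def by (intro openin_Union) auto

lemma thicken_mono: "\<delta> \<le> \<epsilon> \<Longrightarrow> thicken \<delta> A \<subseteq> thicken \<epsilon> A"
  by (auto simp: thicken_def)

lemma thicken_thicken: "thicken \<delta> (thicken \<epsilon> A) \<subseteq> thicken (\<epsilon> + \<delta>) A"
proof
  fix z assume "z \<in> thicken \<delta> (thicken \<epsilon> A)"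
  then obtain a y where *: "a \<in> A" "a \<in> M" "y \<in> M" "z \<in> M" "d a y < \<epsilon>" "d y z < \<delta>"
    by (auto simp: thicken_def)
  then have "d a z < \<epsilon> + \<delta>" using triangle[of a y z] by linarith
  then show "z \<in> thicken (\<epsilon> + \<delta>) A" using * by (auto simp: thicken_def)
qed

lemma thicken_compact_subset_open:
  assumes K: "compactin mtopology K" and U: "openin mtopology U" and "K \<subseteq> U" "\<eta> > 0"
  obtains \<epsilon> where "0 < \<epsilon>" "\<epsilon> \<le> \<eta>" "thicken \<epsilon> K \<subseteq> U"
proof -
  obtain e where e: "0 < e" "\<And>x. x \<in> K \<Longrightarrow> mball x e \<subseteq> U"
    using lebesgue_number[OF K, of "{U}"] \<open>K \<subseteq> U\<close> U by auto
  then have "thicken (min e \<eta>) K \<subseteq> U"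
    by (fastforce simp: thicken_def)
  then show thesis using that[of "min e \<eta>"] e \<open>\<eta> > 0\<close> by simp
qed

text \<open>The one-sided comparison of the Levy-Prohorov metric.\<close>
definition LP_close :: "real \<Rightarrow> 'a measure \<Rightarrow> 'a measure \<Rightarrow> bool" where
  "LP_close \<epsilon> \<mu> \<nu> \<longleftrightarrow>
     (\<forall>A \<in> sets (borel_of mtopology). measure \<mu> A \<le> measure \<nu> (thicken \<epsilon> A) + \<epsilon>)"

lemma sets_thicken: "thicken \<epsilon> A \<in> sets (borel_of mtopology)"
  by (simp add: openin_imp_borel_of openin_thicken)

text \<open>Apply the hypothesis to the complement of the thickening of \<open>A\<close>: the thickening of that
  complement does not meet \<open>A\<close>.\<close>
lemma LP_close_sym:
  assumes \<mu>: "\<mu> \<in> Radon_prob mtopology" and \<nu>: "\<nu> \<in> Radon_prob mtopology" and c: "LP_close \<epsilon> \<mu> \<nu>"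
  shows "LP_close \<epsilon> \<nu> \<mu>"
  unfolding LP_close_def
proof
  fix A assume A: "A \<in> sets (borel_of mtopology)"
  interpret M: prob_space \<mu> using Radon_probD[OF \<mu>] by simp
  interpret N: prob_space \<nu> using Radon_probD[OF \<nu>] by simp
  note s = Radon_probD(2,3)[OF \<mu>] Radon_probD(2,3)[OF \<nu>]
  define B where "B = M - thicken \<epsilon> A"
  have AM: "A \<subseteq> M" using sets.sets_into_space[OF A] by simp
  have B: "B \<in> sets (borel_of mtopology)"
    unfolding B_def using sets.compl_sets[OF sets_thicken] by (metis space_borel_of topspace_mtopology)
  have "thicken \<epsilon> B \<subseteq> M - A"
    using AM by (auto simp: thicken_def B_def commute)
  then have "measure \<nu> (thicken \<epsilon> B) \<le> measure \<nu> (M - A)"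
    using N.finite_measure_mono[of "thicken \<epsilon> B" "M - A"] sets.compl_sets[OF A] s by simp
  moreover have "measure \<mu> B \<le> measure \<nu> (thicken \<epsilon> B) + \<epsilon>"
    using c B by (simp add: LP_close_def)
  moreover have "measure \<mu> B = 1 - measure \<mu> (thicken \<epsilon> A)"
    using M.prob_compl[of "thicken \<epsilon> A"] sets_thicken s by (simp add: B_def)
  moreover have "measure \<nu> (M - A) = 1 - measure \<nu> A"
    using N.prob_compl[of A] A s by simp
  ultimately show "measure \<nu> A \<le> measure \<mu> (thicken \<epsilon> A) + \<epsilon>" by linarith
qed

lemma LP_close_mono:
  assumes \<nu>: "\<nu> \<in> Radon_prob mtopology" and c: "LP_close \<delta> \<mu> \<nu>" and "\<delta> \<le> \<epsilon>"
  shows "LP_close \<epsilon> \<mu> \<nu>"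
  unfolding LP_close_def
proof
  fix A assume A: "A \<in> sets (borel_of mtopology)"
  interpret N: prob_space \<nu> using Radon_probD[OF \<nu>] by simp
  have "measure \<nu> (thicken \<delta> A) \<le> measure \<nu> (thicken \<epsilon> A)"
    by (rule N.finite_measure_mono)
      (use thicken_mono[OF \<open>\<delta> \<le> \<epsilon>\<close>] sets_thicken Radon_probD[OF \<nu>] in auto)
  then show "measure \<mu> A \<le> measure \<nu> (thicken \<epsilon> A) + \<epsilon>"
    using c A \<open>\<delta> \<le> \<epsilon>\<close> by (fastforce simp: LP_close_def)
qed

lemma LP_close_trans:
  assumes \<rho>: "\<rho> \<in> Radon_prob mtopology" and c: "LP_close \<epsilon> \<mu> \<nu>" "LP_close \<delta> \<nu> \<rho>"
  shows "LP_close (\<epsilon> + \<delta>) \<mu> \<rho>"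
  unfolding LP_close_def
proof
  fix A assume A: "A \<in> sets (borel_of mtopology)"
  interpret N: prob_space \<rho> using Radon_probD[OF \<rho>] by simp
  have "measure \<mu> A \<le> measure \<nu> (thicken \<epsilon> A) + \<epsilon>"
    using c(1) A by (simp add: LP_close_def)
  moreover have "measure \<nu> (thicken \<epsilon> A) \<le> measure \<rho> (thicken \<delta> (thicken \<epsilon> A)) + \<delta>"
    using c(2) sets_thicken by (simp add: LP_close_def)
  moreover have "measure \<rho> (thicken \<delta> (thicken \<epsilon> A)) \<le> measure \<rho> (thicken (\<epsilon> + \<delta>) A)"
    by (rule N.finite_measure_mono)
      (use thicken_thicken sets_thicken Radon_probD[OF \<rho>] in auto)
  ultimately show "measure \<mu> A \<le> measure \<rho> (thicken (\<epsilon> + \<delta>) A) + (\<epsilon> + \<delta>)" by linarith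
qed

text \<open>Most of the mass of \<open>U\<close> lies on a compact subset, and some thickening of this subset is still
  contained in \<open>U\<close>.\<close>
lemma LP_close_imp_open_gt:
  assumes \<mu>: "\<mu> \<in> Radon_prob mtopology" and U: "openin mtopology U" and a: "a < measure \<mu> U"
  obtains \<epsilon> where "\<epsilon> > 0"
    "\<And>\<nu>. \<nu> \<in> Radon_prob mtopology \<Longrightarrow> LP_close \<epsilon> \<mu> \<nu> \<Longrightarrow> a < measure \<nu> U"
proof -
  interpret M: prob_space \<mu> using Radon_probD[OF \<mu>] by simp
  note s = Radon_probD(2,3)[OF \<mu>]
  define \<eta> where "\<eta> = (measure \<mu> U - a) / 2"
  have \<eta>: "\<eta> > 0" using a by (simp add: \<eta>_def)
  have Um: "U \<in> sets (borel_of mtopology)" using U by (rule openin_imp_borel_of)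
  obtain K where K: "compactin mtopology K" "K \<subseteq> U" "measure \<mu> (U - K) < \<eta>"
    using Radon_prob_inner[OF \<mu> Um \<eta>] by metis
  have Km: "K \<in> sets (borel_of mtopology)"
    using compactin_imp_borel_of[OF Hausdorff_space_mtopology K(1)] .
  obtain \<epsilon> where \<epsilon>: "0 < \<epsilon>" "\<epsilon> \<le> \<eta>" "thicken \<epsilon> K \<subseteq> U"
    using thicken_compact_subset_open[OF K(1) U K(2) \<eta>] by metis
  have "a < measure \<nu> U" if \<nu>: "\<nu> \<in> Radon_prob mtopology" and c: "LP_close \<epsilon> \<mu> \<nu>" for \<nu>
  proof -
    interpret N: prob_space \<nu> using Radon_probD[OF \<nu>] by simp
    have "measure \<mu> U = measure \<mu> K + measure \<mu> (U - K)"
      using M.finite_measure_Diff[of U K] Um Km K(2) s by simp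
    moreover have "measure \<mu> K \<le> measure \<nu> (thicken \<epsilon> K) + \<epsilon>"
      using c Km by (simp add: LP_close_def)
    moreover have "measure \<nu> (thicken \<epsilon> K) \<le> measure \<nu> U"
      by (rule N.finite_measure_mono) (use \<epsilon> Um Radon_probD[OF \<nu>] in auto)
    ultimately have "measure \<mu> U < measure \<nu> U + 2 * \<eta>" using K(3) \<epsilon>(2) by linarith
    moreover have "2 * \<eta> = measure \<mu> U - a" by (simp add: \<eta>_def)
    ultimately show ?thesis by linarith
  qed
  then show thesis using that \<epsilon>(1) by blast
qed

text \<open>Cover a compact set that carries most of the mass by finitely many small balls. Up to small
  errors, every Borel set is then squeezed between some union of these balls and its own
  thickening; hence closeness to \<open>\<mu>\<close> follows from finitely many lower bounds, one for each union
  of balls.\<close>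
lemma open_gt_imp_LP_close:
  assumes \<mu>: "\<mu> \<in> Radon_prob mtopology" and "\<epsilon> > 0"
  obtains W where "openin (Radon_topology mtopology) W" "\<mu> \<in> W" "\<And>\<nu>. \<nu> \<in> W \<Longrightarrow> LP_close \<epsilon> \<mu> \<nu>"
proof -
  interpret M: prob_space \<mu> using Radon_probD[OF \<mu>] by simp
  note s = Radon_probD(2,3)[OF \<mu>]
  have Mm: "M \<in> sets (borel_of mtopology)"
    using sets.top[of "borel_of mtopology"] by simp
  obtain K where K: "compactin mtopology K" "K \<subseteq> M" "measure \<mu> (M - K) < \<epsilon> / 2"
    using Radon_prob_inner[OF \<mu> Mm, of "\<epsilon> / 2"] \<open>\<epsilon> > 0\<close> by auto
  obtain I where I: "finite I" "I \<subseteq> K" "K \<subseteq> (\<Union>x\<in>I. mball x (\<epsilon> / 2))"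
    using compactin_imp_mtotally_bounded[OF K(1)] \<open>\<epsilon> > 0\<close> unfolding mtotally_bounded_def
    by (metis half_gt_zero)
  define V where "V J = (\<Union>x\<in>J. mball x (\<epsilon> / 2))" for J
  have Vo: "openin mtopology (V J)" for J unfolding V_def by auto
  define W where "W = (\<Inter>J\<in>Pow I. {\<nu> \<in> Radon_prob mtopology. measure \<nu> (V J) > measure \<mu> (V J) - \<epsilon> / 2})"
  have "openin (Radon_topology mtopology) W"
    unfolding W_def using I(1) openin_Radon_topology[OF Vo] by (intro openin_Inter) auto
  moreover have "\<mu> \<in> W" using \<mu> \<open>\<epsilon> > 0\<close> by (simp add: W_def)
  moreover have "LP_close \<epsilon> \<mu> \<nu>" if "\<nu> \<in> W" for \<nu>
    unfolding LP_close_def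
  proof
    fix A assume A: "A \<in> sets (borel_of mtopology)"
    have \<nu>: "\<nu> \<in> Radon_prob mtopology" using that by (auto simp: W_def)
    interpret N: prob_space \<nu> using Radon_probD[OF \<nu>] by simp
    have AM: "A \<subseteq> M" using sets.sets_into_space[OF A] by simp
    define J where "J = {x \<in> I. mball x (\<epsilon> / 2) \<inter> A \<noteq> {}}"
    have MK: "M - K \<in> sets (borel_of mtopology)"
      using Mm compactin_imp_borel_of[OF Hausdorff_space_mtopology K(1)] by blast
    have "A \<subseteq> V J \<union> (M - K)" using I(3) AM by (fastforce simp: V_def J_def)
    then have "measure \<mu> A \<le> measure \<mu> (V J \<union> (M - K))"
      using Vo MK
      by (intro M.finite_measure_mono) (auto simp: s openin_imp_borel_of)
    also have "\<dots> \<le> measure \<mu> (V J) + measure \<mu> (M - K)"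
      using Vo MK
      by (intro measure_Un_le) (auto simp: s openin_imp_borel_of)
    finally have 1: "measure \<mu> A < measure \<mu> (V J) + \<epsilon> / 2" using K(3) by linarith
    have "J \<in> Pow I" by (auto simp: J_def)
    then have 2: "measure \<nu> (V J) > measure \<mu> (V J) - \<epsilon> / 2" using that by (auto simp: W_def)
    have "V J \<subseteq> thicken \<epsilon> A"
    proof
      fix z assume "z \<in> V J"
      then obtain x y where *: "x \<in> M" "y \<in> M" "z \<in> M" "y \<in> A" "d x y < \<epsilon> / 2" "d x z < \<epsilon> / 2"
        by (auto simp: V_def J_def)
      then have "d y z < \<epsilon>" using triangle[of y x z] commute[of x y] by linarith
      then show "z \<in> thicken \<epsilon> A" using * by (auto simp: thicken_def)
    qed
    then have "measure \<nu> (V J) \<le> measure \<nu> (thicken \<epsilon> A)"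
      by (intro N.finite_measure_mono) (use sets_thicken Radon_probD[OF \<nu>] in auto)
    then show "measure \<mu> A \<le> measure \<nu> (thicken \<epsilon> A) + \<epsilon>" using 1 2 by linarith
  qed
  ultimately show thesis using that by blast
qed

text \<open>Adding the element 1 does not change the infimum for probability measures. For other
  arguments it keeps the infimum over a nonempty set, as nonnegativity and symmetry of a metric
  are demanded for all elements of the type.\<close>
definition LP_dist :: "'a measure \<Rightarrow> 'a measure \<Rightarrow> real" where
  "LP_dist \<mu> \<nu> = Inf (insert 1 {\<epsilon>. \<epsilon> > 0 \<and> LP_close \<epsilon> \<mu> \<nu> \<and> LP_close \<epsilon> \<nu> \<mu>})"

lemma LP_dist_less_iff:
  assumes \<mu>: "\<mu> \<in> Radon_prob mtopology" and \<nu>: "\<nu> \<in> Radon_prob mtopology" and "r > 0"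
  shows "LP_dist \<mu> \<nu> < r \<longleftrightarrow> (\<exists>\<epsilon>. 0 < \<epsilon> \<and> \<epsilon> < r \<and> LP_close \<epsilon> \<mu> \<nu>)"
proof -
  interpret M: prob_space \<mu> using Radon_probD[OF \<mu>] by simp
  interpret N: prob_space \<nu> using Radon_probD[OF \<nu>] by simp
  have "LP_close 1 \<mu> \<nu>"
    unfolding LP_close_def using M.prob_le_1 measure_nonneg[of \<nu>]
    by (smt (verit))
  moreover have "bdd_below (insert 1 {\<epsilon>. \<epsilon> > 0 \<and> LP_close \<epsilon> \<mu> \<nu> \<and> LP_close \<epsilon> \<nu> \<mu>})"
    by (rule bdd_belowI[of _ 0]) auto
  ultimately show ?thesis
    unfolding LP_dist_def using LP_close_sym[OF \<mu> \<nu>] LP_close_sym[OF \<nu> \<mu>]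
    by (subst cInf_less_iff) (auto intro: zero_less_one)
qed

lemma LP_dist_nonneg: "0 \<le> LP_dist \<mu> \<nu>"
  unfolding LP_dist_def by (rule cInf_greatest) auto

lemma Metric_space_LP: "Metric_space (Radon_prob mtopology) LP_dist"
proof
  show "0 \<le> LP_dist \<mu> \<nu>" for \<mu> \<nu> by (rule LP_dist_nonneg)
  show "LP_dist \<mu> \<nu> = LP_dist \<nu> \<mu>" for \<mu> \<nu>
    unfolding LP_dist_def by (simp add: conj_commute)
next
  fix \<mu> \<nu> assume \<mu>: "\<mu> \<in> Radon_prob mtopology" and \<nu>: "\<nu> \<in> Radon_prob mtopology"
  interpret M: prob_space \<mu> using Radon_probD[OF \<mu>] by simp
  interpret N: prob_space \<nu> using Radon_probD[OF \<nu>] by simp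
  note s = Radon_probD(2,3)[OF \<mu>] Radon_probD(2,3)[OF \<nu>]
  show "LP_dist \<mu> \<nu> = 0 \<longleftrightarrow> \<mu> = \<nu>"
  proof
    assume 0: "LP_dist \<mu> \<nu> = 0"
    have c: "LP_close \<epsilon> \<mu> \<nu>" if "\<epsilon> > 0" for \<epsilon>
      using LP_dist_less_iff[OF \<mu> \<nu> that] 0 that LP_close_mono[OF \<nu>] by fastforce
    have open_le: "measure \<mu> U \<le> measure \<nu> U" if U: "openin mtopology U" for U
      by (meson LP_close_imp_open_gt[OF \<mu> U] c \<nu> linorder_not_le order.irrefl)
    show "\<mu> = \<nu>"
    proof (rule sym, rule Radon_prob_eqI[OF Hausdorff_space_mtopology \<nu> \<mu>])
      fix K assume K: "compactin mtopology K"
      have Km: "K \<in> sets (borel_of mtopology)"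
        using compactin_imp_borel_of[OF Hausdorff_space_mtopology K] .
      have "measure \<mu> (M - K) \<le> measure \<nu> (M - K)"
        using open_le[of "M - K"] compactin_imp_closedin[OF Hausdorff_space_mtopology K]
        by (simp add: closedin_def)
      then show "measure \<nu> K \<le> measure \<mu> K"
        using M.prob_compl[of K] N.prob_compl[of K] Km s by simp
    qed
  next
    assume eq: "\<mu> = \<nu>"
    have "LP_close \<epsilon> \<mu> \<mu>" if "\<epsilon> > 0" for \<epsilon>
    proof -
      obtain W where "openin (Radon_topology mtopology) W" "\<mu> \<in> W"
        "\<And>\<nu>. \<nu> \<in> W \<Longrightarrow> LP_close \<epsilon> \<mu> \<nu>"
        by (rule open_gt_imp_LP_close[OF \<mu> \<open>\<epsilon> > 0\<close>]) blast
      then show ?thesis by blast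
    qed
    then have "LP_dist \<mu> \<mu> < r" if "r > 0" for r
      using that LP_dist_less_iff[OF \<mu> \<mu> that] dense by blast
    then show "LP_dist \<mu> \<nu> = 0"
      using eq LP_dist_nonneg[of \<mu> \<mu>] by (metis less_eq_real_def order.irrefl)
  qed
next
  fix \<mu> \<nu> \<rho> assume \<mu>: "\<mu> \<in> Radon_prob mtopology" and \<nu>: "\<nu> \<in> Radon_prob mtopology"
    and \<rho>: "\<rho> \<in> Radon_prob mtopology"
  show "LP_dist \<mu> \<rho> \<le> LP_dist \<mu> \<nu> + LP_dist \<nu> \<rho>"
  proof (rule field_le_epsilon)
    fix e :: real assume "e > 0"
    have p: "LP_dist \<mu> \<nu> + e / 2 > 0" "LP_dist \<nu> \<rho> + e / 2 > 0"
      using \<open>e > 0\<close> LP_dist_nonneg[of \<mu> \<nu>] LP_dist_nonneg[of \<nu> \<rho>] by auto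
    obtain \<epsilon> where \<epsilon>: "0 < \<epsilon>" "\<epsilon> < LP_dist \<mu> \<nu> + e / 2" "LP_close \<epsilon> \<mu> \<nu>"
      using LP_dist_less_iff[OF \<mu> \<nu> p(1)] \<open>e > 0\<close> by auto
    obtain \<delta> where \<delta>: "0 < \<delta>" "\<delta> < LP_dist \<nu> \<rho> + e / 2" "LP_close \<delta> \<nu> \<rho>"
      using LP_dist_less_iff[OF \<nu> \<rho> p(2)] \<open>e > 0\<close> by auto
    have c: "LP_close (\<epsilon> + \<delta>) \<mu> \<rho>" using LP_close_trans[OF \<rho> \<epsilon>(3) \<delta>(3)] .
    have "LP_dist \<mu> \<rho> < LP_dist \<mu> \<nu> + LP_dist \<nu> \<rho> + e"
      by (subst LP_dist_less_iff[OF \<mu> \<rho>])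
        (use c \<epsilon> \<delta> p in \<open>auto intro!: exI[of _ "\<epsilon> + \<delta>"]\<close>)
    then show "LP_dist \<mu> \<rho> \<le> LP_dist \<mu> \<nu> + LP_dist \<nu> \<rho> + e" by simp
  qed
qed

lemma mtopology_LP: "Metric_space.mtopology (Radon_prob mtopology) LP_dist = Radon_topology mtopology"
proof -
  interpret LP: Metric_space "Radon_prob mtopology" LP_dist by (rule Metric_space_LP)
  have 1: "openin (Radon_topology mtopology) W" if W: "openin LP.mtopology W" for W
  proof (subst openin_subopen, intro ballI)
    fix \<mu> assume "\<mu> \<in> W"
    then obtain r where r: "r > 0" "LP.mball \<mu> r \<subseteq> W" and \<mu>: "\<mu> \<in> Radon_prob mtopology"
      using W unfolding LP.openin_mtopology by blast
    obtain V where V: "openin (Radon_topology mtopology) V" "\<mu> \<in> V"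
      "\<And>\<nu>. \<nu> \<in> V \<Longrightarrow> LP_close (r / 2) \<mu> \<nu>"
      using open_gt_imp_LP_close[OF \<mu>, of "r / 2"] r(1) by auto
    have "V \<subseteq> LP.mball \<mu> r"
    proof
      fix \<nu> assume "\<nu> \<in> V"
      moreover have \<nu>: "\<nu> \<in> Radon_prob mtopology"
        using openin_subset[OF V(1)] \<open>\<nu> \<in> V\<close> by auto
      ultimately show "\<nu> \<in> LP.mball \<mu> r"
        using V(3)[of \<nu>] r(1) \<mu> LP_dist_less_iff[OF \<mu> \<nu> r(1)]
        by (auto intro!: exI[of _ "r / 2"])
    qed
    then show "\<exists>T. openin (Radon_topology mtopology) T \<and> \<mu> \<in> T \<and> T \<subseteq> W"
      using V r(2) by blast
  qed
  have 2: "continuous_map LP.mtopology (Radon_topology mtopology) id"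
  proof (rule continuous_map_into_Radon_topology)
    fix U and a :: real assume U: "openin mtopology U"
    have "\<exists>r>0. LP.mball \<mu> r \<subseteq> {\<nu> \<in> Radon_prob mtopology. a < measure \<nu> U}"
      if \<mu>: "\<mu> \<in> Radon_prob mtopology" and a: "a < measure \<mu> U" for \<mu>
    proof -
      obtain \<epsilon> where \<epsilon>: "\<epsilon> > 0"
        "\<And>\<nu>. \<nu> \<in> Radon_prob mtopology \<Longrightarrow> LP_close \<epsilon> \<mu> \<nu> \<Longrightarrow> a < measure \<nu> U"
        using LP_close_imp_open_gt[OF \<mu> U a] by metis
      have "LP.mball \<mu> \<epsilon> \<subseteq> {\<nu> \<in> Radon_prob mtopology. a < measure \<nu> U}"
      proof
        fix \<nu> assume "\<nu> \<in> LP.mball \<mu> \<epsilon>"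
        then have \<nu>: "\<nu> \<in> Radon_prob mtopology" "LP_dist \<mu> \<nu> < \<epsilon>" by auto
        then show "\<nu> \<in> {\<nu> \<in> Radon_prob mtopology. a < measure \<nu> U}"
          using LP_dist_less_iff[OF \<mu> \<nu>(1) \<epsilon>(1)] LP_close_mono[OF \<nu>(1)] \<epsilon>(2) by force
      qed
      then show ?thesis using \<epsilon>(1) by blast
    qed
    then show "openin LP.mtopology {\<nu> \<in> topspace LP.mtopology. a < measure (id \<nu>) U}"
      unfolding LP.openin_mtopology by auto
  qed simp
  have "openin LP.mtopology W" if W: "openin (Radon_topology mtopology) W" for W
  proof -
    have "{x \<in> topspace LP.mtopology. id x \<in> W} = W"
      using openin_subset[OF W] by auto
    then show ?thesis using openin_continuous_map_preimage[OF 2 W] by simp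
  qed
  then show ?thesis using 1 by (auto simp: topology_eq)
qed

end

text \<open>On a nonseparable \<open>X\<close> this is a feature of Radon measures: their mass is concentrated on
  compact sets up to small errors, so that finitely many small balls suffice in
  \<open>open_gt_imp_LP_close\<close>.\<close>
lemma metrizable_space_Radon_topology:
  assumes "metrizable_space X" shows "metrizable_space (Radon_topology X)"
proof -
  obtain M d where "Metric_space M d" and X: "X = Metric_space.mtopology M d"
    using assms by (auto simp: metrizable_space_def)
  then interpret Metric_space M d by simp
  show ?thesis
    unfolding metrizable_space_def X using Metric_space_LP mtopology_LP by metis
qed

section \<open>Coding sigma-compact metrizable sets by real numbers\<close>

text \<open>The Marczewski function of a sequence of sets. Only the ternary digits 0 and 1 occur, so
  that nearby values have the same initial digits.\<close>
definition ternary_code :: "(nat \<Rightarrow> 'a set) \<Rightarrow> 'a \<Rightarrow> real" where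
  "ternary_code V x = (\<Sum>k. indicator (V k) x * (1/3) ^ Suc k)"

lemma summable_ternary_code: "summable (\<lambda>k. indicator (V k) x * (1/3::real) ^ Suc k)"
  by (rule summable_comparison_test'[of "\<lambda>k. (1/3::real) ^ Suc k"])
    (auto simp: indicator_def summable_geometric summable_mult)

lemma ternary_code_bounds: "0 \<le> ternary_code V x" "ternary_code V x \<le> 1/2"
proof -
  have "summable (\<lambda>k. (1/3::real) ^ k)" by (simp add: summable_geometric)
  then have s: "summable (\<lambda>k. (1/3::real) ^ Suc k)" by (subst summable_Suc_iff)
  have "(\<Sum>k. (1/3::real) ^ Suc k) = (1/3) * (\<Sum>k. (1/3::real) ^ k)"
    using suminf_mult[OF \<open>summable (\<lambda>k. (1/3::real) ^ k)\<close>, of "1/3"] by simp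
  then have e: "(\<Sum>k. (1/3::real) ^ Suc k) = 1/2"
    by (simp add: suminf_geometric)
  show "0 \<le> ternary_code V x"
    unfolding ternary_code_def by (rule suminf_nonneg[OF summable_ternary_code]) simp
  have "ternary_code V x \<le> (\<Sum>k. (1/3::real) ^ Suc k)"
    unfolding ternary_code_def
    by (rule suminf_le[OF _ summable_ternary_code s]) (simp add: indicator_def)
  then show "ternary_code V x \<le> 1/2" using e by simp
qed

lemma ternary_code_Suc:
  "ternary_code V x = (indicator (V 0) x + ternary_code (\<lambda>k. V (Suc k)) x) / 3"
proof -
  have "ternary_code V x = indicator (V 0) x * (1/3) + (\<Sum>k. indicator (V (Suc k)) x * (1/3::real) ^ Suc (Suc k))"
    unfolding ternary_code_def using suminf_split_head[OF summable_ternary_code, of V x] by simp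
  also have "(\<Sum>k. indicator (V (Suc k)) x * (1/3::real) ^ Suc (Suc k))
      = (\<Sum>k. (1/3) * (indicator (V (Suc k)) x * (1/3::real) ^ Suc k))"
    by (simp add: mult_ac)
  also have "\<dots> = (1/3) * ternary_code (\<lambda>k. V (Suc k)) x"
    unfolding ternary_code_def by (rule suminf_mult[OF summable_ternary_code])
  finally show ?thesis by (simp add: field_simps)
qed

lemma ternary_code_close_imp_agree_0:
  assumes "\<bar>ternary_code V x - ternary_code V y\<bar> < 1/6"
  shows "x \<in> V 0 \<longleftrightarrow> y \<in> V 0"
proof -
  have "ternary_code V x - ternary_code V y < 1/6" "ternary_code V y - ternary_code V x < 1/6"
    using assms by (simp_all only: abs_less_iff minus_diff_eq)
  then have "indicator (V 0) x - indicator (V 0) y < (1::real)"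
    "indicator (V 0) y - indicator (V 0) x < (1::real)"
    using ternary_code_bounds[of "\<lambda>k. V (Suc k)" x] ternary_code_bounds[of "\<lambda>k. V (Suc k)" y]
      ternary_code_Suc[of V x] ternary_code_Suc[of V y]
    by argo+
  then show ?thesis by (auto simp: indicator_def split: if_splits)
qed

text \<open>The first digit at which two codes differ contributes more than all later digits together.\<close>
lemma ternary_code_close_imp_agree:
  assumes "\<bar>ternary_code V x - ternary_code V y\<bar> < (1/3) ^ Suc N / 2" and "k \<le> N"
  shows "x \<in> V k \<longleftrightarrow> y \<in> V k"
  using assms
proof (induction N arbitrary: V k)
  case 0
  then show ?case
    using ternary_code_close_imp_agree_0[of V x y] by simp
next
  case (Suc N)
  have "(1/3) ^ Suc (Suc N) / 2 \<le> (1/3::real) ^ 1 / 2"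
    by (intro divide_right_mono power_decreasing) auto
  then have "\<bar>ternary_code V x - ternary_code V y\<bar> < 1/6"
    using Suc.prems(1) by simp
  then have 0: "x \<in> V 0 \<longleftrightarrow> y \<in> V 0"
    by (rule ternary_code_close_imp_agree_0)
  show ?case
  proof (cases k)
    case (Suc j)
    have "\<bar>ternary_code (\<lambda>k. V (Suc k)) x - ternary_code (\<lambda>k. V (Suc k)) y\<bar> < (1/3) ^ Suc N / 2"
      using Suc.prems(1) 0 ternary_code_Suc[of V x] ternary_code_Suc[of V y]
      by (simp add: indicator_def field_simps abs_if split: if_splits)
    from Suc.IH[OF this, of j] show ?thesis using Suc.prems(2) Suc by simp
  qed (use 0 in simp)
qed

text \<open>A \<open>\<sigma>\<close>-compact set in a metrizable space is a continuous image of a closed set \<open>D\<close> of reals,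
  by a map \<open>g\<close> that has a Borel right inverse \<open>c\<close>. This replaces, for the present purposes, the
  classical surjection from the Cantor set onto a compact metrizable space.

  The code of \<open>x\<close> consists of the first index \<open>m\<close> with \<open>x \<in> K m\<close> as its integral part and of the
  Marczewski function of a countable family of small balls as its fractional part. If two codes
  are close, then the points lie in the same \<open>K m\<close> and in a common small ball. So the decoding
  map is uniformly continuous on the codes with a given integral part; as \<open>K m\<close> is compact, it
  extends to limits of such codes with values in \<open>K m\<close>. The integral part keeps limits of codes
  from leaving the union of the sets \<open>K m\<close>: it makes \<open>D\<close> closed in the line although the union
  need not be complete.\<close>
lemma (in Metric_space) coding_of_sigma_compact:
  fixes K :: "nat \<Rightarrow> 'a set"
  assumes K: "\<And>m. compactin mtopology (K m)" and "M \<noteq> {}"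
  obtains c :: "'a \<Rightarrow> real" and D :: "real set" and g :: "real \<Rightarrow> 'a"
  where "closed D" "continuous_map (top_of_set D) mtopology g"
    "c \<in> borel_measurable (borel_of mtopology)"
    "\<And>x m. x \<in> K m \<Longrightarrow> c x \<in> D \<and> g (c x) = x"
    "\<And>x m. x \<in> K m \<Longrightarrow> 0 \<le> c x \<and> c x \<le> real m + 1"
proof -
  have KM: "K m \<subseteq> M" for m using compactin_subset_topspace[OF K[of m]] by simp
  have "\<forall>m n. \<exists>I. finite I \<and> I \<subseteq> K m \<and> K m \<subseteq> (\<Union>x\<in>I. mball x (1 / real (Suc n)))"
    using compactin_imp_mtotally_bounded[OF K] unfolding mtotally_bounded_def by simp
  then obtain I where I: "\<And>m n. finite (I m n)" "\<And>m n. I m n \<subseteq> K m"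
    "\<And>m n. K m \<subseteq> (\<Union>x\<in>I m n. mball x (1 / real (Suc n)))"
    by metis
  define \<V> where "\<V> m n = (\<lambda>x. mball x (1 / real (Suc n))) ` I m n" for m n
  define \<W> where "\<W> = insert {} (\<Union>m. \<Union>n. \<V> m n)"
  have cW: "countable \<W>" "\<W> \<noteq> {}"
    unfolding \<W>_def \<V>_def using I(1)
    by (auto intro!: countable_insert countable_UN countable_image intro: countable_finite)
  define V where "V = from_nat_into \<W>"
  have rV: "range V = \<W>" unfolding V_def using range_from_nat_into[OF cW(2,1)] .
  have Vo: "openin mtopology (V k)" for k
  proof -
    have "V k \<in> \<W>" using rV by blast
    then show ?thesis by (auto simp: \<W>_def \<V>_def)
  qed
  \<comment> \<open>The second summand is at most 1/2, so that codes with different integral parts have a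
    distance of at least 1/2.\<close>
  define c where "c x = real (LEAST m. x \<in> K m) + ternary_code V x" for x
  define W where "W = (\<Union>m. K m)"
  have least: "x \<in> K (LEAST m. x \<in> K m)" if "x \<in> W" for x
    using that unfolding W_def by (auto intro: LeastI)
  have Kb: "K m \<in> sets (borel_of mtopology)" for m
    using compactin_imp_borel_of[OF Hausdorff_space_mtopology K] .
  have "(\<lambda>x. LEAST m. x \<in> K m) \<in> measurable (borel_of mtopology) (count_space UNIV)"
    by (rule measurable_Least) (use Kb in measurable)
  moreover have "ternary_code V \<in> borel_measurable (borel_of mtopology)"
    unfolding ternary_code_def[abs_def] using openin_imp_borel_of[OF Vo] by measurable
  ultimately have cm: "c \<in> borel_measurable (borel_of mtopology)"
    unfolding c_def[abs_def] by measurable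
  have cb: "0 \<le> c x \<and> c x \<le> real m + 1" if "x \<in> K m" for x m
  proof -
    have "(LEAST m. x \<in> K m) \<le> m" using that by (rule Least_le)
    then show ?thesis using ternary_code_bounds[of V x] by (simp add: c_def)
  qed
  have same: "(LEAST m. x \<in> K m) = (LEAST m. y \<in> K m)" if "\<bar>c x - c y\<bar> < 1/2" for x y
  proof -
    have "\<bar>real (LEAST m. x \<in> K m) - real (LEAST m. y \<in> K m)\<bar> < 1"
      using that[unfolded c_def] ternary_code_bounds[of V x] ternary_code_bounds[of V y] by linarith
    then show ?thesis by linarith
  qed
  have close: "\<exists>\<delta>>0. \<delta> \<le> 1/2 \<and> (\<forall>x\<in>W. \<forall>y\<in>W. (LEAST m. x \<in> K m) = m \<and> \<bar>c x - c y\<bar> < \<delta> \<longrightarrow> d x y < \<epsilon>)"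
    if "\<epsilon> > 0" for \<epsilon> m
  proof -
    obtain n where n: "1 / real (Suc n) < \<epsilon> / 2"
      using \<open>\<epsilon> > 0\<close> by (meson half_gt_zero nat_approx_posE)
    have "\<V> m n \<subseteq> V ` UNIV" unfolding rV \<W>_def by blast
    then obtain F where F: "finite F" "\<V> m n = V ` F"
      using finite_subset_image[of "\<V> m n" V UNIV] I(1) by (auto simp: \<V>_def)
    then obtain N where N: "\<And>k. k \<in> F \<Longrightarrow> k \<le> N"
      by (meson finite_nat_set_iff_bounded_le)
    have "d x y < \<epsilon>"
      if xy: "x \<in> W" "y \<in> W" and m: "(LEAST m. x \<in> K m) = m"
        and cl: "\<bar>c x - c y\<bar> < min (1/2) ((1/3) ^ Suc N / 2)" for x y
    proof -
      have "x \<in> K m" using least[OF xy(1)] m by simp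
      then obtain z where z: "z \<in> I m n" "x \<in> mball z (1 / real (Suc n))" using I(3) by blast
      have "mball z (1 / real (Suc n)) \<in> V ` F"
        unfolding F(2)[symmetric] \<V>_def using z(1) by (rule imageI)
      then obtain k where k: "k \<in> F" "V k = mball z (1 / real (Suc n))"
        by (metis imageE)
      have "(LEAST m. y \<in> K m) = m" using same[of x y] cl m by simp
      then have "\<bar>ternary_code V x - ternary_code V y\<bar> < (1/3) ^ Suc N / 2"
        using cl m by (simp add: c_def)
      from ternary_code_close_imp_agree[OF this N[OF k(1)]]
      have "y \<in> mball z (1 / real (Suc n))"
        using z(2) unfolding k(2) by (rule iffD1)
      then have "d z x < \<epsilon> / 2" "d z y < \<epsilon> / 2" "x \<in> M" "y \<in> M" "z \<in> M"
        using z n by auto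
      then show ?thesis using triangle[of x z y] commute[of x z] by linarith
    qed
    then show ?thesis by (intro exI[of _ "min (1/2) ((1/3) ^ Suc N / 2)"]) auto
  qed
  have inj: "x = y" if "x \<in> W" "y \<in> W" "c x = c y" for x y
  proof (rule ccontr)
    assume "x \<noteq> y"
    have "x \<in> M" "y \<in> M" using that KM by (auto simp: W_def)
    then have "d x y > 0" using \<open>x \<noteq> y\<close> by (simp add: less_le)
    from close[OF this, of "LEAST m. x \<in> K m"] show False using that by force
  qed
  define h where "h = inv_into W c"
  have hc: "h (c x) = x" if "x \<in> W" for x
    unfolding h_def using that inj by (intro inv_into_f_f) (auto simp: inj_on_def)
  define S where "S = c ` W"
  \<comment> \<open>The codes near \<open>t\<close> have one common integral part \<open>m\<close>, and the decoded points cluster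
    in the compact set \<open>K m\<close>; uniform continuity turns a cluster point into a limit.\<close>
  have lim: "\<exists>l. limitin mtopology h l (atin_within euclidean t S) \<and> (t \<in> S \<longrightarrow> l = h t)"
    if t: "t \<in> closure S" for t
  proof -
    obtain s where s: "\<And>n::nat. s n \<in> S" "s \<longlonglongrightarrow> t"
      using t unfolding closure_sequential by blast
    have "\<forall>n. \<exists>z. z \<in> W \<and> s n = c z" using s(1) unfolding S_def by blast
    then obtain x where x: "\<And>n. x n \<in> W" "\<And>n. s n = c (x n)" by metis
    have "eventually (\<lambda>n. dist (s n) t < 1/4) sequentially"
      using s(2) by (rule tendstoD) simp
    then obtain n0 where n0: "\<And>n. n \<ge> n0 \<Longrightarrow> \<bar>s n - t\<bar> < 1/4"
      unfolding eventually_sequentially dist_real_def by blast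
    define m where "m = (LEAST m. x n0 \<in> K m)"
    have m: "(LEAST m. z \<in> K m) = m" if "\<bar>c z - t\<bar> < 1/4" for z
    proof -
      have "\<bar>c z - c (x n0)\<bar> < 1/2" using that n0[of n0] x(2)[of n0] by linarith
      from same[OF this] show ?thesis by (simp add: m_def)
    qed
    have xK: "x n \<in> K m" if "n \<ge> n0" for n
      using least[OF x(1)[of n]] m[of "x n"] n0[OF that] x(2) by simp
    have "range (\<lambda>n. x (n + n0)) \<subseteq> K m" using xK by auto
    then obtain l r where l: "l \<in> K m" "strict_mono (r :: nat \<Rightarrow> nat)"
      "limitin mtopology ((\<lambda>n. x (n + n0)) \<circ> r) l sequentially"
      using K[of m] unfolding compactin_sequentially by meson
    have lM: "l \<in> M" using l(1) KM by blast
    have near: "\<exists>\<delta>>0. \<forall>z\<in>W. \<bar>c z - t\<bar> < \<delta> \<longrightarrow> d z l < \<epsilon>" if "\<epsilon> > 0" for \<epsilon>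
    proof -
      obtain \<delta> where \<delta>: "\<delta> > 0" "\<delta> \<le> 1/2"
        "\<And>x y. x \<in> W \<Longrightarrow> y \<in> W \<Longrightarrow> (LEAST m. x \<in> K m) = m \<Longrightarrow> \<bar>c x - c y\<bar> < \<delta> \<Longrightarrow> d x y < \<epsilon> / 2"
        using close[of "\<epsilon> / 2" m] \<open>\<epsilon> > 0\<close> by auto
      have "(\<lambda>n. s (r n + n0)) \<longlonglongrightarrow> t"
        using LIMSEQ_subseq_LIMSEQ[OF LIMSEQ_ignore_initial_segment[OF s(2), of n0] l(2)]
        by (simp add: o_def)
      then have "eventually (\<lambda>n. dist (s (r n + n0)) t < \<delta> / 2) sequentially"
        by (rule tendstoD) (use \<delta> in simp)
      moreover have "eventually (\<lambda>n. x (r n + n0) \<in> M \<and> d (x (r n + n0)) l < \<epsilon> / 2) sequentially"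
        using l(3) half_gt_zero[OF \<open>\<epsilon> > 0\<close>] unfolding limitin_metric o_def by blast
      ultimately have "eventually (\<lambda>n. dist (s (r n + n0)) t < \<delta> / 2
          \<and> x (r n + n0) \<in> M \<and> d (x (r n + n0)) l < \<epsilon> / 2) sequentially"
        by (rule eventually_conj)
      from eventually_happens'[OF sequentially_bot this]
      obtain n where n: "dist (s (r n + n0)) t < \<delta> / 2" "d (x (r n + n0)) l < \<epsilon> / 2" by blast
      have "d z l < \<epsilon>" if z: "z \<in> W" "\<bar>c z - t\<bar> < \<delta> / 2" for z
      proof -
        have 1: "(LEAST m. z \<in> K m) = m" by (rule m) (use z(2) \<delta>(2) in linarith)
        have "\<bar>c z - c (x (r n + n0))\<bar> \<le> \<bar>c z - t\<bar> + \<bar>s (r n + n0) - t\<bar>"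
          unfolding x(2) by linarith
        also have "\<dots> < \<delta> / 2 + \<delta> / 2"
          using z(2) n(1) unfolding dist_real_def by (rule add_strict_mono)
        finally have 2: "\<bar>c z - c (x (r n + n0))\<bar> < \<delta>" by simp
        have "d z (x (r n + n0)) < \<epsilon> / 2" by (rule \<delta>(3)[OF z(1) x(1) 1 2])
        moreover have "z \<in> M" "x (r n + n0) \<in> M" using z(1) x(1) KM by (auto simp: W_def)
        ultimately show ?thesis using n(2) triangle[of z "x (r n + n0)" l] lM by linarith
      qed
      then show ?thesis using \<delta>(1) half_gt_zero by blast
    qed
    have "limitin mtopology h l (atin_within euclidean t S)"
      unfolding limitin_metric
    proof (intro conjI allI impI)
      fix \<epsilon> :: real assume "\<epsilon> > 0"
      then obtain \<delta> where \<delta>: "\<delta> > 0" "\<And>z. z \<in> W \<Longrightarrow> \<bar>c z - t\<bar> < \<delta> \<Longrightarrow> d z l < \<epsilon>"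
        using near by blast
      have "h u \<in> M \<and> d (h u) l < \<epsilon>" if "u \<in> S" "u \<in> ball t \<delta>" for u
      proof -
        obtain z where z: "z \<in> W" "u = c z" using \<open>u \<in> S\<close> by (auto simp: S_def)
        moreover have "\<bar>c z - t\<bar> < \<delta>"
          using \<open>u \<in> ball t \<delta>\<close> z(2) by (simp add: dist_real_def abs_minus_commute)
        ultimately have "d z l < \<epsilon>" using \<delta>(2) by blast
        moreover have "z \<in> M" using z(1) KM by (auto simp: W_def)
        ultimately show ?thesis using hc[OF z(1)] z(2) by simp
      qed
      then show "eventually (\<lambda>u. h u \<in> M \<and> d (h u) l < \<epsilon>) (atin_within euclidean t S)"
        unfolding eventually_atin_within
        by (intro disjI2 exI[of _ "ball t \<delta>"]) (use \<delta>(1) in auto)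
    qed (rule lM)
    moreover have "l = h t" if "t \<in> S"
    proof -
      obtain z where z: "z \<in> W" "t = c z" using \<open>t \<in> S\<close> by (auto simp: S_def)
      have small: "d z l < \<epsilon>" if "\<epsilon> > 0" for \<epsilon> using near[OF that] z by force
      have "z \<in> M" using z KM by (auto simp: W_def)
      moreover have "d z l = 0"
        using small[of "d z l"] nonneg[of z l] by linarith
      ultimately have "z = l" using lM by simp
      then show ?thesis using hc z by simp
    qed
    ultimately show ?thesis by blast
  qed
  have hS: "continuous_map (subtopology euclidean S) mtopology h"
    unfolding continuous_map_atin
  proof (intro ballI)
    fix t assume "t \<in> topspace (subtopology euclidean S)"
    then have "t \<in> S" by simp
    then show "limitin mtopology h (h t) (atin (subtopology euclidean S) t)"
      using lim[of t] closure_subset by (auto simp: atin_subtopology_within)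
  qed
  obtain g where g: "continuous_map (subtopology euclidean (closure S)) mtopology g"
    "\<And>u. u \<in> S \<Longrightarrow> g u = h u"
  proof (rule continuous_map_extension_pointwise_alt[OF regular_space_mtopology _ _ hS])
    show "S \<subseteq> closure S" by (rule closure_subset)
    show "closure S \<subseteq> euclidean closure_of S" by simp
    show "\<And>t. t \<in> closure S - S \<Longrightarrow> \<exists>l. limitin mtopology h l (atin_within euclidean t S)"
      using lim by blast
  qed blast
  show thesis
  proof (rule that[OF closed_closure g(1) cm])
    show "c x \<in> closure S \<and> g (c x) = x" if "x \<in> K m" for x m
    proof -
      have "x \<in> W" using that by (auto simp: W_def)
      then show ?thesis using g(2)[of "c x"] hc closure_subset[of S] by (auto simp: S_def)
    qed
  qed (use cb in auto)
qed

section \<open>Measures on the line and their continuous images\<close>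

lemma borel_of_euclidean: "borel_of euclidean = borel"
  by (simp add: borel_of_def borel_def)

lemma Radon_prob_real:
  "Radon_prob (euclidean :: real topology) = {\<nu>. real_distribution \<nu>}"
proof -
  have "\<exists>K. compact K \<and> K \<subseteq> B \<and> measure \<nu> (B - K) < \<epsilon>"
    if \<nu>: "real_distribution \<nu>" and \<epsilon>: "\<epsilon> > 0" and B: "B \<in> sets borel" for \<nu> \<epsilon> B
  proof -
    interpret N: real_distribution \<nu> by fact
    show ?thesis
    proof (cases "measure \<nu> B < \<epsilon>")
      case True
      then show ?thesis by (intro exI[of _ "{}"]) simp
    next
      case False
      have "ennreal (measure \<nu> B - \<epsilon>) < emeasure \<nu> B"
        using \<epsilon> False by (simp add: N.emeasure_eq_measure ennreal_less_iff)
      also have "emeasure \<nu> B = (SUP K \<in> {K. K \<subseteq> B \<and> compact K}. emeasure \<nu> K)"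
        using B by (intro inner_regular) (auto simp: N.emeasure_eq_measure)
      finally obtain K where K: "K \<subseteq> B" "compact K" "ennreal (measure \<nu> B - \<epsilon>) < emeasure \<nu> K"
        unfolding less_SUP_iff by blast
      then have "measure \<nu> B - \<epsilon> < measure \<nu> K"
        using False by (simp add: N.emeasure_eq_measure ennreal_less_iff)
      then have "measure \<nu> (B - K) < \<epsilon>"
        using N.finite_measure_Diff[of B K] B K by (simp add: borel_compact)
      then show ?thesis using K by blast
    qed
  qed
  then show ?thesis
    unfolding Radon_prob_def borel_of_euclidean
    by (auto simp: real_distribution_def real_distribution_axioms_def)
qed

text \<open>One half of the portmanteau theorem, in the form that matches the subbasis of the topology
  on Radon measures: compare the open set with a compact subset and a continuous function
  between the two indicator functions.\<close>
lemma weak_conv_open_gt: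
  assumes d: "\<And>n. real_distribution (\<mu> n)" "real_distribution \<nu>" and w: "weak_conv_m \<mu> \<nu>"
    and V: "open V" and a: "a < measure \<nu> V"
  shows "eventually (\<lambda>n. a < measure (\<mu> n) V) sequentially"
proof -
  interpret N: real_distribution \<nu> by fact
  have "V \<in> sets (borel_of euclidean)" using V by (simp add: borel_of_euclidean)
  then obtain K where K: "compact K" "K \<subseteq> V" "measure \<nu> (V - K) < measure \<nu> V - a"
    using Radon_prob_inner[of \<nu> euclidean V "measure \<nu> V - a"] d(2) a
    by (auto simp: Radon_prob_real)
  have aK: "a < measure \<nu> K"
    using K(3) N.finite_measure_Diff[of V K] K V by (simp add: borel_compact)
  obtain \<phi> :: "real \<Rightarrow> real" where \<phi>: "continuous_on UNIV \<phi>" "\<And>x. \<phi> x \<in> closed_segment 1 0"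
    "\<And>x. x \<in> K \<Longrightarrow> \<phi> x = 1" "\<And>x. x \<in> - V \<Longrightarrow> \<phi> x = 0"
    using Urysohn[of K "- V" 1 "0::real"] K V compact_imp_closed by blast
  have b: "0 \<le> \<phi> x" "\<phi> x \<le> 1" for x using \<phi>(2)[of x] by (auto simp: closed_segment_eq_real_ivl)
  have m: "\<phi> \<in> borel_measurable borel" using \<phi>(1) by (rule borel_measurable_continuous_onI)
  have lim: "(\<lambda>n. integral\<^sup>L (\<mu> n) \<phi>) \<longlonglongrightarrow> integral\<^sup>L \<nu> \<phi>"
    by (rule weak_conv_imp_integral_bdd_continuous_conv[OF d w, of \<phi> 1])
      (use \<phi>(1) b in \<open>auto simp: continuous_on_eq_continuous_at\<close>)
  have int: "integrable P \<phi>" if "real_distribution P" for P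
  proof -
    interpret P: real_distribution P by fact
    show ?thesis
      by (rule P.integrable_const_bound[of _ 1]) (use b m in auto)
  qed
  have "measure \<nu> K = (\<integral>x. indicator K x \<partial>\<nu>)"
    by (simp add: N.space_eq_univ)
  also have "\<dots> \<le> integral\<^sup>L \<nu> \<phi>"
  proof (rule integral_mono[OF _ int[OF d(2)]])
    show "integrable \<nu> (indicat_real K)"
      using K(1) by (simp add: N.emeasure_eq_measure borel_compact)
    show "indicat_real K x \<le> \<phi> x" for x
      using b \<phi>(3) by (simp add: indicator_def)
  qed
  finally have "a < integral\<^sup>L \<nu> \<phi>" using aK by simp
  then have "eventually (\<lambda>n. a < integral\<^sup>L (\<mu> n) \<phi>) sequentially"
    using lim by (simp add: order_tendsto_iff)
  moreover have "integral\<^sup>L (\<mu> n) \<phi> \<le> measure (\<mu> n) V" for n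
  proof -
    interpret P: real_distribution "\<mu> n" by (rule d)
    have "integral\<^sup>L (\<mu> n) \<phi> \<le> (\<integral>x. indicator V x \<partial>\<mu> n)"
    proof (rule integral_mono[OF int[OF d(1)]])
      show "integrable (\<mu> n) (indicat_real V)"
        using V by (simp add: P.emeasure_eq_measure)
      show "\<phi> x \<le> indicat_real V x" for x
        using b \<phi>(4) by (simp add: indicator_def)
    qed
    also have "\<dots> = measure (\<mu> n) V" by (simp add: P.space_eq_univ)
    finally show ?thesis .
  qed
  ultimately show ?thesis
    by (auto elim!: eventually_mono intro: less_le_trans)
qed

text \<open>The image of the part of \<open>\<nu>\<close> on \<open>D\<close> under a map for which only the values on \<open>D\<close> matter.\<close>
definition image_measure_on :: "'a topology \<Rightarrow> real set \<Rightarrow> (real \<Rightarrow> 'a) \<Rightarrow> real measure \<Rightarrow> 'a measure" where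
  "image_measure_on X D g \<nu> = distr (restrict_space \<nu> D) (borel_of X) g"

lemma continuous_map_measurable_restrict_space:
  assumes "real_distribution \<nu>" and g: "continuous_map (top_of_set D) X g"
  shows "g \<in> measurable (restrict_space \<nu> D) (borel_of X)"
proof (rule measurable_borel_ofI)
  interpret N: real_distribution \<nu> by fact
  have sp: "space (restrict_space \<nu> D) = D"
    by (simp add: space_restrict_space N.space_eq_univ)
  show "g \<in> space (restrict_space \<nu> D) \<rightarrow> topspace X"
    using g by (auto simp: sp continuous_map_def)
  fix U assume "openin X U"
  then have "openin (top_of_set D) {x \<in> D. g x \<in> U}"
    using openin_continuous_map_preimage[OF g] by simp
  then obtain V where V: "open V" "{x \<in> D. g x \<in> U} = D \<inter> V"
    by (auto simp: openin_open)
  have "g -` U \<inter> space (restrict_space \<nu> D) = D \<inter> V"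
    using V(2) sp by blast
  then show "g -` U \<inter> space (restrict_space \<nu> D) \<in> sets (restrict_space \<nu> D)"
    using V(1) by (auto simp: sets_restrict_space)
qed

lemma measure_image_measure_on:
  assumes \<nu>: "real_distribution \<nu>" and D: "closed D"
    and g: "continuous_map (top_of_set D) X g" and B: "B \<in> sets (borel_of X)"
  shows "D \<inter> g -` B \<in> sets borel" "measure (image_measure_on X D g \<nu>) B = measure \<nu> (D \<inter> g -` B)"
proof -
  interpret N: real_distribution \<nu> by fact
  have sp: "space (restrict_space \<nu> D) = D"
    by (simp add: space_restrict_space N.space_eq_univ)
  note gm = continuous_map_measurable_restrict_space[OF \<nu> g]
  have Ds: "D \<inter> space \<nu> \<in> sets \<nu>" using D by (simp add: N.space_eq_univ)
  have "g -` B \<inter> D \<in> sets (restrict_space \<nu> D)"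
    using measurable_sets[OF gm B] sp by simp
  then show 1: "D \<inter> g -` B \<in> sets borel"
    using sets_restrict_space_iff[OF Ds] by (simp add: Int_commute)
  show "measure (image_measure_on X D g \<nu>) B = measure \<nu> (D \<inter> g -` B)"
    unfolding image_measure_on_def using measure_distr[OF gm B] measure_restrict_space[OF Ds, of "g -` B \<inter> D"]
    by (simp add: sp Int_commute)
qed

text \<open>All finite Borel measures on the line are inner regular, and this passes to continuous
  images. The measures that are constructed below on metrizable spaces are all obtained in this
  way, which is how they are seen to be Radon.\<close>
lemma image_measure_on_in_Radon_prob:
  assumes X: "Hausdorff_space X" and \<nu>: "real_distribution \<nu>" and D: "closed D" "measure \<nu> D = 1"
    and g: "continuous_map (top_of_set D) X g"
  shows "image_measure_on X D g \<nu> \<in> Radon_prob X"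
proof -
  interpret N: real_distribution \<nu> by fact
  note gm = continuous_map_measurable_restrict_space[OF \<nu> g]
  have Ds: "D \<inter> space \<nu> \<in> sets \<nu>" using D by (simp add: N.space_eq_univ)
  have "prob_space (restrict_space \<nu> D)"
    by (rule prob_space_restrict_space) (use D in \<open>auto simp: N.emeasure_eq_measure\<close>)
  then have p: "prob_space (image_measure_on X D g \<nu>)"
    unfolding image_measure_on_def by (rule prob_space.prob_space_distr[OF _ gm])
  then interpret P: prob_space "image_measure_on X D g \<nu>" .
  have sP: "sets (image_measure_on X D g \<nu>) = sets (borel_of X)" by (simp add: image_measure_on_def)
  have "\<exists>K. compactin X K \<and> K \<subseteq> B \<and> measure (image_measure_on X D g \<nu>) (B - K) < \<epsilon>"
    if "\<epsilon> > 0" and B: "B \<in> sets (borel_of X)" for \<epsilon> B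
  proof -
    have "D \<inter> g -` B \<in> sets (borel_of euclidean)"
      using measure_image_measure_on(1)[OF \<nu> D(1) g B] by (simp add: borel_of_euclidean)
    then obtain C where C: "compact C" "C \<subseteq> D \<inter> g -` B" "measure \<nu> (D \<inter> g -` B - C) < \<epsilon>"
      using Radon_prob_inner[of \<nu> euclidean "D \<inter> g -` B" \<epsilon>] \<nu> \<open>\<epsilon> > 0\<close>
      by (auto simp: Radon_prob_real)
    have "compactin (top_of_set D) C" using C by (simp add: compactin_subtopology)
    then have gC: "compactin X (g ` C)" using g by (rule image_compactin)
    have gCm: "B - g ` C \<in> sets (borel_of X)"
      using B compactin_imp_borel_of[OF X gC] by blast
    have "measure (image_measure_on X D g \<nu>) (B - g ` C) = measure \<nu> (D \<inter> g -` (B - g ` C))"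
      by (rule measure_image_measure_on(2)[OF \<nu> D(1) g gCm])
    also have "\<dots> \<le> measure \<nu> (D \<inter> g -` B - C)"
      by (rule N.finite_measure_mono)
        (use measure_image_measure_on(1)[OF \<nu> D(1) g B] C(1) in \<open>auto simp: borel_compact\<close>)
    finally show ?thesis using gC C(2,3) by (intro exI[of _ "g ` C"]) auto
  qed
  then show ?thesis unfolding Radon_prob_def using p sP by simp
qed

section \<open>Sequential compactness of uniformly tight sequences\<close>

lemma real_distribution_distr:
  assumes "prob_space \<mu>" "t \<in> borel_measurable \<mu>"
  shows "real_distribution (distr \<mu> borel t)"
  using assms by (simp add: real_distribution_def real_distribution_axioms_def prob_space.prob_space_distr)

text \<open>The direct half of Prohorov's theorem, for sequences. A coding of the \<open>\<sigma>\<close>-compact set that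
  carries all the measures transports the sequence to the line, where it stays tight because
  codes of points of \<open>K m\<close> are bounded. Helly's selection theorem gives a weakly convergent
  subsequence there. Its limit is concentrated on the closed set \<open>D\<close> and is carried back by the
  continuous decoding map.\<close>
lemma uniformly_tight_imp_convergent_subsequence:
  assumes X: "metrizable_space X" and \<sigma>: "\<And>n::nat. \<sigma> n \<in> Radon_prob X"
    and tight: "uniformly_tight X (range \<sigma>)"
  obtains r \<mu> where "strict_mono (r :: nat \<Rightarrow> nat)" "limitin (Radon_topology X) (\<sigma> \<circ> r) \<mu> sequentially"
proof -
  obtain M d where "Metric_space M d" and XM: "X = Metric_space.mtopology M d"
    using X by (auto simp: metrizable_space_def)
  then interpret Metric_space M d by simp
  have H: "Hausdorff_space X" using X by (rule metrizable_imp_Hausdorff_space)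
  have top: "topspace X = M" by (simp add: XM)
  have "\<forall>m. \<exists>K. compactin X K \<and> (\<forall>\<mu>\<in>range \<sigma>. measure \<mu> (topspace X - K) < 1 / real (Suc m))"
    using tight by (simp add: uniformly_tight_def)
  then obtain K where K: "\<And>m. compactin X (K m)"
    "\<And>m n. measure (\<sigma> n) (topspace X - K m) < 1 / real (Suc m)"
    by (metis rangeI)
  have p: "prob_space (\<sigma> n)" for n using Radon_probD[OF \<sigma>] by simp
  note s = Radon_probD(2,3)[OF \<sigma>]
  have Kb: "K m \<in> sets (borel_of X)" for m by (rule compactin_imp_borel_of[OF H K(1)])
  have "M \<noteq> {}" using prob_space.not_empty[OF p[of 0]] s(2) top by simp
  then obtain c D g where D: "closed D" and g: "continuous_map (top_of_set D) X g"
    and c: "c \<in> borel_measurable (borel_of X)"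
    and cD: "\<And>x m. x \<in> K m \<Longrightarrow> c x \<in> D \<and> g (c x) = x"
    and cb: "\<And>x m. x \<in> K m \<Longrightarrow> 0 \<le> c x \<and> c x \<le> real m + 1"
    using coding_of_sigma_compact[of K] K(1) unfolding XM by metis
  have cm: "c \<in> borel_measurable (\<sigma> n)" for n
    using c measurable_cong_sets[OF s(1) refl] by blast
  define \<nu> where "\<nu> n = distr (\<sigma> n) borel c" for n
  have \<nu>: "real_distribution (\<nu> n)" for n
    unfolding \<nu>_def by (rule real_distribution_distr[OF p cm])
  have \<nu>m: "measure (\<nu> n) B = measure (\<sigma> n) (c -` B \<inter> topspace X)" if "B \<in> sets borel" for n B
    unfolding \<nu>_def using measure_distr[OF cm that] s by simp
  have \<nu>K: "1 - 1 / real (Suc m) < measure (\<nu> n) B"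
    if B: "B \<in> sets borel" "\<And>x. x \<in> K m \<Longrightarrow> c x \<in> B" for n m B
  proof -
    interpret P: prob_space "\<sigma> n" by (rule p)
    have "measure (\<sigma> n) (K m) \<le> measure (\<nu> n) B"
      unfolding \<nu>m[OF B(1)]
      by (rule P.finite_measure_mono)
        (use B compactin_subset_topspace[OF K(1)] measurable_sets[OF cm[of n] B(1)] s in auto)
    then show ?thesis using K(2)[of n m] P.prob_compl[of "K m"] Kb s by simp
  qed
  have "tight \<nu>"
    unfolding tight_def
  proof (intro conjI allI impI \<nu>)
    fix \<epsilon> :: real assume "\<epsilon> > 0"
    then obtain m where m: "1 / real (Suc m) < \<epsilon>" using nat_approx_posE by metis
    have "1 - \<epsilon> < measure (\<nu> n) {-1<..real m + 1}" for n
      using \<nu>K[of "{-1<..real m + 1}" m n] cb[of _ m] m by force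
    then show "\<exists>a b. a < b \<and> (\<forall>n. 1 - \<epsilon> < measure (\<nu> n) {a<..b})"
      by (intro exI[of _ "-1"] exI[of _ "real m + 1"]) auto
  qed
  from tight_imp_convergent_subsubsequence[OF this strict_mono_id]
  obtain r \<rho> where r: "strict_mono r" and \<rho>: "real_distribution \<rho>" and w: "weak_conv_m (\<nu> \<circ> r) \<rho>"
    by (auto simp: o_def)
  interpret R: real_distribution \<rho> by (rule \<rho>)
  have gt: "eventually (\<lambda>n. a < measure (\<nu> (r n)) V) sequentially" if "open V" "a < measure \<rho> V" for V a
    using weak_conv_open_gt[OF _ \<rho> w that] \<nu> by (simp add: o_def)
  have \<nu>D: "measure (\<nu> n) (- D) = 0" for n
  proof -
    interpret P: real_distribution "\<nu> n" by (rule \<nu>)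
    have "measure (\<nu> n) (- D) \<le> 0 + e" if "e > 0" for e
    proof -
      obtain m where m: "1 / real (Suc m) < e" using nat_approx_posE \<open>e > 0\<close> by metis
      have "1 - 1 / real (Suc m) < measure (\<nu> n) D" using \<nu>K[of D m n] D cD by auto
      then show ?thesis using P.prob_compl[of D] D m by (simp add: P.space_eq_univ Compl_eq_Diff_UNIV)
    qed
    then have "measure (\<nu> n) (- D) \<le> 0" by (rule field_le_epsilon)
    then show ?thesis using measure_nonneg[of "\<nu> n" "- D"] by linarith
  qed
  have "measure \<rho> (- D) = 0"
  proof (rule ccontr)
    assume "measure \<rho> (- D) \<noteq> 0"
    then have "0 < measure \<rho> (- D)" by (simp add: less_le)
    from eventually_happens'[OF sequentially_bot gt[OF _ this]] D \<nu>D show False by auto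
  qed
  then have \<rho>D: "measure \<rho> D = 1"
    using R.prob_compl[of D] D by (simp add: R.space_eq_univ Compl_eq_Diff_UNIV)
  define \<mu> where "\<mu> = image_measure_on X D g \<rho>"
  have \<mu>: "\<mu> \<in> Radon_prob X" unfolding \<mu>_def by (rule image_measure_on_in_Radon_prob[OF H \<rho> D \<rho>D g])
  have "limitin (Radon_topology X) (\<sigma> \<circ> r) \<mu> sequentially"
  proof (rule limitin_Radon_topologyI[OF \<mu>])
    show "eventually (\<lambda>n. (\<sigma> \<circ> r) n \<in> Radon_prob X) sequentially" using \<sigma> by simp
    fix U a assume U: "openin X U" and a: "a < measure \<mu> U"
    have Um: "U \<in> sets (borel_of X)" by (rule openin_imp_borel_of[OF U])
    have "openin (top_of_set D) {x \<in> D. g x \<in> U}"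
      using openin_continuous_map_preimage[OF g U] by simp
    then obtain V where V: "open V" "{x \<in> D. g x \<in> U} = D \<inter> V"
      by (auto simp: openin_open)
    have DV: "D \<inter> g -` U = D \<inter> V" using V(2) by blast
    have "measure \<mu> U = measure \<rho> (D \<inter> V)"
      unfolding \<mu>_def using measure_image_measure_on(2)[OF \<rho> D g Um] DV by simp
    also have "\<dots> \<le> measure \<rho> V"
      by (rule R.finite_measure_mono) (use V(1) in auto)
    finally have "a < measure \<rho> V" using a by simp
    then have ev: "eventually (\<lambda>n. a < measure (\<nu> (r n)) V) sequentially" by (rule gt[OF V(1)])
    have le: "measure (\<nu> n) V \<le> measure (\<sigma> n) U" for n
    proof (rule field_le_epsilon)
      fix e :: real assume "e > 0"
      then obtain m where m: "1 / real (Suc m) < e" using nat_approx_posE by metis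
      interpret P: prob_space "\<sigma> n" by (rule p)
      have cV: "c -` V \<inter> topspace X \<in> sets (\<sigma> n)"
        using measurable_sets[OF cm[of n], of V] V(1) s by simp
      have XK: "topspace X - K m \<in> sets (\<sigma> n)" using sets.compl_sets[of "K m" "\<sigma> n"] Kb s by simp
      have "c -` V \<inter> topspace X \<subseteq> U \<union> (topspace X - K m)"
      proof
        fix x assume x: "x \<in> c -` V \<inter> topspace X"
        show "x \<in> U \<union> (topspace X - K m)"
        proof (cases "x \<in> K m")
          case True
          then have "c x \<in> D \<inter> g -` U" unfolding DV using cD x by blast
          then show ?thesis using cD[OF True] by simp
        qed (use x in simp)
      qed
      then have "measure (\<sigma> n) (c -` V \<inter> topspace X) \<le> measure (\<sigma> n) (U \<union> (topspace X - K m))"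
        by (rule P.finite_measure_mono) (use Um XK s in simp)
      also have "\<dots> \<le> measure (\<sigma> n) U + measure (\<sigma> n) (topspace X - K m)"
        by (rule measure_Un_le) (use Um XK s in auto)
      also have "\<dots> \<le> measure (\<sigma> n) U + e" using K(2)[of n m] m by simp
      finally show "measure (\<nu> n) V \<le> measure (\<sigma> n) U + e" using \<nu>m V(1) by simp
    qed
    show "eventually (\<lambda>n. a < measure ((\<sigma> \<circ> r) n) U) sequentially"
      using ev by (rule eventually_mono) (use le less_le_trans in \<open>auto simp: o_def\<close>)
  qed
  with r show thesis by (rule that)
qed

section \<open>Lifting Radon measures along a section\<close>

text \<open>An arbitrary function \<open>s\<close> can be replaced by a measurable one without leaving, up to null
  sets, any closed set in which \<open>s\<close> takes its values on a measurable set. The exceptional null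
  set depends on that closed set.

  The new function \<open>t\<close> is the least measurable majorant of \<open>s\<close>, found by minimising the integral
  of \<open>arctan \<circ> h\<close> over all measurable majorants \<open>h\<close>; the bound \<open>b\<close> provides one majorant. If on a
  nonnull part of \<open>A\<close> the values of \<open>t\<close> were in a gap of \<open>F\<close>, then the values of \<open>s\<close> would be
  below the gap there, and \<open>t\<close> could be lowered to the lower end of the gap.\<close>
lemma (in prob_space) measurable_selection_of_arbitrary_function:
  fixes s b :: "'a \<Rightarrow> real"
  assumes b: "b \<in> borel_measurable M" and s: "\<And>x. x \<in> space M \<Longrightarrow> s x \<le> b x"
  obtains t where "t \<in> borel_measurable M"
    "\<And>A F. A \<in> sets M \<Longrightarrow> closed F \<Longrightarrow> s ` A \<subseteq> F \<Longrightarrow> AE x in M. x \<in> A \<longrightarrow> t x \<in> F"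
proof -
  define H where "H = {h \<in> borel_measurable M. \<forall>x\<in>space M. s x \<le> h x}"
  define J where "J h = (\<integral>x. arctan (h x) \<partial>M)" for h
  have bH: "b \<in> H" using b s by (simp add: H_def)
  have abs_arctan: "\<bar>arctan z\<bar> \<le> pi / 2" for z
    using arctan_bounded[of z] by linarith
  have int: "integrable M (\<lambda>x. arctan (h x))" if "h \<in> H" for h
    by (rule integrable_const_bound[of _ "pi / 2"]) (use that abs_arctan in \<open>auto simp: H_def\<close>)
  have "- (pi / 2) \<le> J h" if "h \<in> H" for h
  proof -
    have "(\<integral>x. - (pi / 2) \<partial>M) \<le> J h"
      unfolding J_def using arctan_lbound by (intro integral_mono int that) (auto simp: less_imp_le)
    then show ?thesis by (simp add: prob_space)
  qed
  then have bdd: "bdd_below (J ` H)" by (intro bdd_belowI2[of _ "- (pi / 2)"])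
  have "\<exists>h. h \<in> H \<and> J h < Inf (J ` H) + 1 / real (Suc n)" for n
  proof -
    have "Inf (J ` H) < Inf (J ` H) + 1 / real (Suc n)" by simp
    then have "\<exists>y\<in>J ` H. y < Inf (J ` H) + 1 / real (Suc n)"
      using cInf_less_iff[of "J ` H"] bdd bH by blast
    then show ?thesis by blast
  qed
  then obtain h where h: "\<And>n. h n \<in> H" "\<And>n. J (h n) < Inf (J ` H) + 1 / real (Suc n)" by metis
  define t where "t x = (INF n. h n x)" for x
  have bddx: "bdd_below (range (\<lambda>n. h n x))" if "x \<in> space M" for x
    using h(1) that by (intro bdd_belowI2[of _ "s x"]) (auto simp: H_def)
  have tH: "t \<in> H"
    unfolding H_def
  proof (intro CollectI conjI ballI)
    show "t \<in> borel_measurable M"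
      unfolding t_def[abs_def]
      by (rule borel_measurable_cINF) (use h(1) bddx in \<open>auto simp: H_def\<close>)
    show "s x \<le> t x" if "x \<in> space M" for x
      unfolding t_def by (rule cINF_greatest) (use h(1) that in \<open>auto simp: H_def\<close>)
  qed
  have tm: "t \<in> borel_measurable M" using tH by (simp add: H_def)
  have "J t \<le> Inf (J ` H)"
  proof (rule field_le_epsilon)
    fix e :: real assume "e > 0"
    then obtain n where n: "1 / real (Suc n) < e" using nat_approx_posE by metis
    have "J t \<le> J (h n)"
      unfolding J_def
    proof (rule integral_mono[OF int[OF tH] int[OF h(1)]])
      fix x assume "x \<in> space M"
      then have "t x \<le> h n x" unfolding t_def using bddx by (intro cINF_lower) auto
      then show "arctan (t x) \<le> arctan (h n x)" by (rule arctan_monotone')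
    qed
    then show "J t \<le> Inf (J ` H) + e" using h(2)[of n] n by linarith
  qed
  then have min: "J t \<le> J k" if "k \<in> H" for k
    using cINF_lower[OF bdd that] by linarith
  have gap: "AE x in M. \<not> (x \<in> A \<and> p < t x \<and> t x < q)"
    if A: "A \<in> sets M" and F: "s ` A \<subseteq> F" and pq: "{p..q} \<inter> F = {}" for A F p q
  proof -
    define B where "B = {x \<in> space M. x \<in> A \<and> p < t x \<and> t x < q}"
    have Bm: "B \<in> sets M" unfolding B_def using A tm by measurable
    define k where "k x = (if x \<in> B then p else t x)" for x
    have "s x \<le> k x" if "x \<in> space M" for x
    proof (cases "x \<in> B")
      case True
      then have "s x \<in> F" "s x \<le> t x" "t x < q" using F tH that by (auto simp: B_def H_def)
      moreover have "s x \<notin> {p..q}" using \<open>s x \<in> F\<close> pq by blast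
      ultimately have "s x < p" by auto
      then show ?thesis using True by (simp add: k_def)
    qed (use tH that in \<open>auto simp: k_def H_def\<close>)
    moreover have "k \<in> borel_measurable M"
      unfolding k_def[abs_def] using tm Bm by measurable
    ultimately have kH: "k \<in> H" by (simp add: H_def)
    have kt: "arctan (k x) \<le> arctan (t x)" for x
      by (rule arctan_monotone') (auto simp: k_def B_def)
    have i: "integrable M (\<lambda>x. arctan (t x) - arctan (k x))"
      by (rule Bochner_Integration.integrable_diff[OF int[OF tH] int[OF kH]])
    have "(\<integral>x. arctan (t x) - arctan (k x) \<partial>M) = J t - J k"
      unfolding J_def by (rule Bochner_Integration.integral_diff[OF int[OF tH] int[OF kH]])
    moreover have "0 \<le> (\<integral>x. arctan (t x) - arctan (k x) \<partial>M)"
      using kt by (intro integral_nonneg_AE) auto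
    ultimately have "(\<integral>x. arctan (t x) - arctan (k x) \<partial>M) = 0"
      using min[OF kH] by linarith
    then have "AE x in M. arctan (t x) - arctan (k x) = 0"
      using integral_nonneg_eq_0_iff_AE[OF i] kt by auto
    then show ?thesis
    proof (rule AE_mp, intro AE_I2 impI notI)
      fix x assume x: "x \<in> space M" and eq: "arctan (t x) - arctan (k x) = 0"
        and xB: "x \<in> A \<and> p < t x \<and> t x < q"
      have "k x = p" using x xB by (simp add: k_def B_def)
      moreover have "t x = k x" using eq arctan_eq_iff by simp
      ultimately show False using xB by simp
    qed
  qed
  have "AE x in M. x \<in> A \<longrightarrow> t x \<in> F" if A: "A \<in> sets M" and F: "closed F" "s ` A \<subseteq> F" for A F
  proof -
    \<comment> \<open>Countably many gaps with rational end points cover the complement of \<open>F\<close>.\<close>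
    have "AE x in M. \<forall>p q :: rat. {real_of_rat p..real_of_rat q} \<inter> F = {}
        \<longrightarrow> \<not> (x \<in> A \<and> real_of_rat p < t x \<and> t x < real_of_rat q)"
      unfolding AE_all_countable using gap[OF A F(2)] by (intro allI) (auto intro: AE_I2)
    then show ?thesis
    proof (rule AE_mp, intro AE_I2 impI)
      fix x assume *: "\<forall>p q :: rat. {real_of_rat p..real_of_rat q} \<inter> F = {}
          \<longrightarrow> \<not> (x \<in> A \<and> real_of_rat p < t x \<and> t x < real_of_rat q)" and "x \<in> A"
      show "t x \<in> F"
      proof (rule ccontr)
        assume "t x \<notin> F"
        then obtain e where e: "e > 0" "ball (t x) e \<subseteq> - F"
          using F(1) open_contains_ball[of "- F"] by auto
        obtain p :: rat where p: "t x - e < of_rat p" "of_rat p < t x"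
          using of_rat_dense[of "t x - e" "t x"] e(1) by auto
        obtain q :: rat where q: "t x < of_rat q" "of_rat q < t x + e"
          using of_rat_dense[of "t x" "t x + e"] e(1) by auto
        have "{real_of_rat p..real_of_rat q} \<subseteq> ball (t x) e"
          using p q by (auto simp: dist_real_def)
        then have "{real_of_rat p..real_of_rat q} \<inter> F = {}" using e(2) by blast
        then show False using * \<open>x \<in> A\<close> p q by blast
      qed
    qed
  qed
  with tm show thesis by (rule that)
qed

text \<open>The measure \<open>\<nu>\<close> is a substitute for the image of \<open>\<mu>\<close> under \<open>s\<close>, which need not exist, as \<open>s\<close>
  may fail to be measurable: it has the lower bounds that the image measure would have,
  for all compact \<open>K\<close> simultaneously. To obtain it, compose \<open>s\<close> with a coding of the closures of
  \<open>s ` L m\<close>, where the compact sets \<open>L m\<close> exhaust \<open>\<mu>\<close>, replace this real function by a measurable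
  selection, and decode the distribution of the selection.\<close>
lemma Radon_lift_along_section:
  assumes X: "metrizable_space X" and Y: "Hausdorff_space Y" and \<mu>: "\<mu> \<in> Radon_prob Y"
    and s: "\<And>y. y \<in> topspace Y \<Longrightarrow> s y \<in> topspace X"
    and sK: "\<And>K. compactin Y K \<Longrightarrow> compactin X (X closure_of (s ` K))"
  obtains \<nu> where "\<nu> \<in> Radon_prob X"
    "\<And>K. compactin Y K \<Longrightarrow> measure \<mu> K \<le> measure \<nu> (X closure_of (s ` K))"
proof -
  obtain N d where "Metric_space N d" and XM: "X = Metric_space.mtopology N d"
    using X by (auto simp: metrizable_space_def)
  then interpret Metric_space N d by simp
  have H: "Hausdorff_space X" using X by (rule metrizable_imp_Hausdorff_space)
  have top: "topspace X = N" by (simp add: XM)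
  interpret M: prob_space \<mu> using Radon_probD[OF \<mu>] by simp
  note sp = Radon_probD(2,3)[OF \<mu>]
  have "\<exists>L. compactin Y L \<and> measure \<mu> (topspace Y - L) < 1 / real (Suc m)" for m
    using Radon_prob_inner[OF \<mu> openin_imp_borel_of[OF openin_topspace], of "1 / real (Suc m)"]
    by (metis zero_less_divide_1_iff of_nat_0_less_iff zero_less_Suc)
  then obtain L where L: "\<And>m. compactin Y (L m)"
    "\<And>m. measure \<mu> (topspace Y - L m) < 1 / real (Suc m)" by metis
  have Lm: "L m \<in> sets \<mu>" for m using compactin_imp_borel_of[OF Y L(1)] sp by simp
  obtain y where "y \<in> topspace Y" using M.not_empty sp(2) by blast
  then have "N \<noteq> {}" using s[of y] top by blast
  then obtain c D g where D: "closed D" and g: "continuous_map (top_of_set D) X g"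
    and cD: "\<And>x m. x \<in> X closure_of (s ` L m) \<Longrightarrow> c x \<in> D \<and> g (c x) = x"
    and cb: "\<And>x m. x \<in> X closure_of (s ` L m) \<Longrightarrow> 0 \<le> c x \<and> c x \<le> real m + 1"
    using coding_of_sigma_compact[of "\<lambda>m. X closure_of (s ` L m)"] sK[OF L(1)]
    unfolding XM by metis
  have in_cl: "s y \<in> X closure_of (s ` K)" if "compactin Y K" "y \<in> K" for K y
  proof -
    have "s ` K \<subseteq> topspace X" using s compactin_subset_topspace[OF that(1)] by auto
    then show ?thesis using closure_of_subset that(2) by blast
  qed
  define W where "W = (\<Union>m. L m)"
  have Wm: "W \<in> sets \<mu>" unfolding W_def using Lm by blast
  have "measure \<mu> (topspace Y - W) \<le> 0 + e" if e: "e > 0" for e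
  proof -
    obtain m where m: "1 / real (Suc m) < e" using nat_approx_posE[OF e] by metis
    have "measure \<mu> (topspace Y - W) \<le> measure \<mu> (topspace Y - L m)"
      by (rule M.finite_measure_mono) (use sets.compl_sets[OF Lm] sp in \<open>auto simp: W_def\<close>)
    then show ?thesis using L(2)[of m] m by simp
  qed
  then have "measure \<mu> (topspace Y - W) \<le> 0" by (rule field_le_epsilon)
  then have "measure \<mu> (topspace Y - W) = 0"
    using measure_nonneg[of \<mu> "topspace Y - W"] by linarith
  then have W1: "measure \<mu> W = 1" using M.prob_compl[OF Wm] sp by simp
  \<comment> \<open>The value off the null set \<open>topspace Y - W\<close> is arbitrary; it only has to respect the
    measurable bound \<open>b\<close>.\<close>
  define s' where "s' y = (if y \<in> W then c (s y) else 0)" for y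
  define b where "b y = real (LEAST m. y \<in> L m) + 1" for y
  have "(\<lambda>y. LEAST m. y \<in> L m) \<in> measurable \<mu> (count_space UNIV)"
    by (rule measurable_Least) (use Lm in measurable)
  then have bm: "b \<in> borel_measurable \<mu>" unfolding b_def[abs_def] by measurable
  have s'b: "s' y \<le> b y" for y
  proof (cases "y \<in> W")
    case True
    then have "y \<in> L (LEAST m. y \<in> L m)" unfolding W_def by (auto intro: LeastI)
    then show ?thesis
      using cb[OF in_cl[OF L(1)]] True by (simp add: s'_def b_def)
  qed (simp add: s'_def b_def)
  obtain t where t: "t \<in> borel_measurable \<mu>"
    "\<And>A F. A \<in> sets \<mu> \<Longrightarrow> closed F \<Longrightarrow> s' ` A \<subseteq> F \<Longrightarrow> AE y in \<mu>. y \<in> A \<longrightarrow> t y \<in> F"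
    using M.measurable_selection_of_arbitrary_function[OF bm s'b] by metis
  define \<rho> where "\<rho> = distr \<mu> borel t"
  have \<rho>: "real_distribution \<rho>"
    unfolding \<rho>_def by (rule real_distribution_distr[OF M.prob_space_axioms t(1)])
  interpret R: real_distribution \<rho> by (rule \<rho>)
  have \<rho>F: "measure \<mu> A \<le> measure \<rho> F" if A: "A \<in> sets \<mu>" and F: "closed F" "s' ` A \<subseteq> F" for A F
  proof -
    have Fm: "t -` F \<inter> space \<mu> \<in> sets \<mu>" using measurable_sets[OF t(1)] F(1) by simp
    have "measure \<mu> A \<le> measure \<mu> (t -` F \<inter> space \<mu>)"
      by (rule M.finite_measure_mono_AE)
        (use t(2)[OF A F] Fm sets.sets_into_space[OF A] in \<open>auto elim!: AE_mp intro!: AE_I2\<close>)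
    also have "\<dots> = measure \<rho> F" unfolding \<rho>_def using measure_distr[OF t(1)] F(1) by simp
    finally show ?thesis .
  qed
  have s'D: "s' y \<in> D" "g (s' y) = s y" if yW: "y \<in> W" for y
  proof -
    obtain m where "y \<in> L m" using yW by (auto simp: W_def)
    then show "s' y \<in> D" "g (s' y) = s y"
      using cD[OF in_cl[OF L(1)]] yW by (auto simp: s'_def)
  qed
  have "1 \<le> measure \<rho> D" using \<rho>F[OF Wm D] s'D(1) W1 by auto
  then have \<rho>D: "measure \<rho> D = 1" using R.prob_le_1[of D] by linarith
  define \<nu> where "\<nu> = image_measure_on X D g \<rho>"
  have "\<nu> \<in> Radon_prob X" unfolding \<nu>_def by (rule image_measure_on_in_Radon_prob[OF H \<rho> D \<rho>D g])
  moreover have "measure \<mu> K \<le> measure \<nu> (X closure_of (s ` K))" if K: "compactin Y K" for K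
  proof -
    define C where "C = X closure_of (s ` K)"
    have C: "closedin X C" by (simp add: C_def)
    have Km: "K \<in> sets \<mu>" using compactin_imp_borel_of[OF Y K] sp by simp
    have "closedin (top_of_set D) {r \<in> D. g r \<in> C}"
      using closedin_continuous_map_preimage[OF g C] by simp
    then have "closedin (top_of_set D) (D \<inter> g -` C)"
      by (simp add: vimage_def Int_def conj_commute)
    then have F: "closed (D \<inter> g -` C)" using D closedin_closed_trans by blast
    have "s' ` (K \<inter> W) \<subseteq> D \<inter> g -` C"
      using s'D in_cl[OF K] by (auto simp: C_def)
    from \<rho>F[OF _ F this] have "measure \<mu> (K \<inter> W) \<le> measure \<rho> (D \<inter> g -` C)" using Km Wm by blast
    also have "\<dots> = measure \<nu> C"
      unfolding \<nu>_def using measure_image_measure_on(2)[OF \<rho> D g closedin_imp_borel_of[OF C]] by simp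
    finally have "measure \<mu> (K \<inter> W) \<le> measure \<nu> C" .
    moreover have "measure \<mu> K \<le> measure \<mu> (K \<inter> W) + measure \<mu> (topspace Y - W)"
    proof -
      have Wc: "topspace Y - W \<in> sets \<mu>" using sets.compl_sets[OF Wm] sp by simp
      have "measure \<mu> K \<le> measure \<mu> ((K \<inter> W) \<union> (topspace Y - W))"
        by (rule M.finite_measure_mono)
          (use compactin_subset_topspace[OF K] Km Wm Wc in auto)
      also have "\<dots> \<le> measure \<mu> (K \<inter> W) + measure \<mu> (topspace Y - W)"
        by (rule measure_Un_le) (use Km Wm Wc in auto)
      finally show ?thesis .
    qed
    ultimately show ?thesis
      using \<open>measure \<mu> (topspace Y - W) = 0\<close> by (simp add: C_def)
  qed
  ultimately show thesis by (rule that)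
qed

section \<open>Subproperness of the map between spaces of Radon measures\<close>

text \<open>A continuous injection of a compact space into a Hausdorff space is an embedding, so the
  compact set is itself metrizable.\<close>
lemma compactin_sequentially_if_injects_into_metrizable:
  assumes C: "compactin T C" and M: "metrizable_space M" and f: "continuous_map T M f"
    and inj: "inj_on f C" and \<sigma>: "range \<sigma> \<subseteq> C"
  obtains r l where "strict_mono (r :: nat \<Rightarrow> nat)" "l \<in> C" "limitin T (\<sigma> \<circ> r) l sequentially"
proof -
  have top: "topspace (subtopology T C) = C"
    using compactin_subset_topspace[OF C] by auto
  have "embedding_map (subtopology T C) M f"
    by (rule continuous_imp_embedding_map)
      (use C f M inj top in \<open>auto simp: compact_space_subtopology continuous_map_from_subtopology
        metrizable_imp_Hausdorff_space\<close>)
  then have "metrizable_space (subtopology T C)"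
    using M metrizable_space_subtopology homeomorphic_metrizable_space
      embedding_map_imp_homeomorphic_space by metis
  then obtain S d where "Metric_space S d" and S: "subtopology T C = Metric_space.mtopology S d"
    by (auto simp: metrizable_space_def)
  then interpret Metric_space S d by simp
  have "compactin (subtopology T C) C" using C by (simp add: compactin_subtopology)
  then obtain l r where "l \<in> C" "strict_mono (r :: nat \<Rightarrow> nat)"
    "limitin (subtopology T C) (\<sigma> \<circ> r) l sequentially"
    using \<sigma> unfolding S compactin_sequentially by meson
  then show thesis using that by (simp add: limitin_subtopology)
qed

lemma (in Metric_space) compactin_closure_of_if_subsequences:
  assumes SM: "S \<subseteq> M"
    and seq: "\<And>\<sigma> :: nat \<Rightarrow> 'a. range \<sigma> \<subseteq> S \<Longrightarrow> \<exists>r l. strict_mono (r :: nat \<Rightarrow> nat) \<and> limitin mtopology (\<sigma> \<circ> r) l sequentially"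
  shows "compactin mtopology (mtopology closure_of S)"
  unfolding compact_closure_of_eq_Bolzano_Weierstrass
proof (intro allI impI)
  fix T assume T: "infinite T \<and> T \<subseteq> S \<and> T \<subseteq> M"
  then obtain \<sigma> :: "nat \<Rightarrow> 'a" where \<sigma>: "inj \<sigma>" "range \<sigma> \<subseteq> T"
    using infinite_countable_subset by blast
  then obtain r l where r: "strict_mono (r :: nat \<Rightarrow> nat)" and l: "limitin mtopology (\<sigma> \<circ> r) l sequentially"
    using seq[of \<sigma>] T by blast
  have "l \<in> mtopology derived_set_of T"
    unfolding in_derived_set_of
  proof (intro conjI allI impI)
    show "l \<in> topspace mtopology" using l by (rule limitin_topspace)
    fix U assume U: "l \<in> U \<and> openin mtopology U"
    have "eventually (\<lambda>n. \<sigma> (r n) \<in> U) sequentially"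
      using limitinD[OF l] U by (auto simp: o_def)
    then obtain n0 where n0: "\<And>n. n \<ge> n0 \<Longrightarrow> \<sigma> (r n) \<in> U"
      unfolding eventually_sequentially by blast
    have "r n0 \<noteq> r (Suc n0)" using strict_mono_eq[OF r] by simp
    then have "\<sigma> (r n0) \<noteq> \<sigma> (r (Suc n0))" using injD[OF \<sigma>(1)] by blast
    then have "\<sigma> (r n0) \<noteq> l \<or> \<sigma> (r (Suc n0)) \<noteq> l" by metis
    then show "\<exists>y. y \<noteq> l \<and> y \<in> T \<and> y \<in> U"
      using n0[of n0] n0[of "Suc n0"] \<sigma>(2) by auto
  qed
  then show "mtopology derived_set_of T \<noteq> {}" by blast
qed

theorem theorem9p6:
  fixes X :: "'a topology" and Y :: "'b topology" and f :: "'a \<Rightarrow> 'b"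
  assumes "metrizable_space X"
    and "Tychonoff_space Y" and "submetrizable_space Y" and "sequentially_Prohorov_space Y"
    and "subproper_map X Y f" and "f ` topspace X = topspace Y"
  shows "subproper_map (Radon_topology X) (Radon_topology Y) (Radon_map Y f)"
proof -
  note X = assms(1)
  have HX: "Hausdorff_space X" using X by (rule metrizable_imp_Hausdorff_space)
  have HY: "Hausdorff_space Y" using assms(2) by (simp add: Tychonoff_space_def)
  obtain Z where f: "continuous_map X Y f" and Z: "Z \<subseteq> topspace X" "f ` Z = topspace Y"
    and ZK: "\<And>K. precompact_in Y K \<Longrightarrow> precompact_in X (Z \<inter> f -` K)"
    using assms(5) unfolding subproper_map_def by blast
  define s where "s = inv_into Z f"
  have s: "s y \<in> Z \<and> f (s y) = y" if "y \<in> topspace Y" for y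
    using that Z(2) by (simp add: s_def inv_into_into f_inv_into_f)
  have sK: "compactin X (X closure_of (s ` K))" if K: "compactin Y K" for K
  proof -
    have "precompact_in Y K"
      using K compactin_subset_topspace[OF K] compactin_imp_closedin[OF HY K]
      by (simp add: precompact_in_def closure_of_closedin)
    then have "compactin X (X closure_of (Z \<inter> f -` K))"
      using ZK by (simp add: precompact_in_def)
    moreover have "s ` K \<subseteq> Z \<inter> f -` K" using s compactin_subset_topspace[OF K] by auto
    ultimately show ?thesis
      using closed_compactin[OF _ closure_of_mono closedin_closure_of] by blast
  qed
  have fcl: "X closure_of (s ` K) \<subseteq> f -` K \<inter> topspace X" if K: "compactin Y K" for K
  proof -
    have "closedin X {x \<in> topspace X. f x \<in> K}"
      by (rule closedin_continuous_map_preimage[OF f compactin_imp_closedin[OF HY K]])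
    moreover have "s ` K \<subseteq> {x \<in> topspace X. f x \<in> K}"
      using s Z(1) compactin_subset_topspace[OF K] by auto
    ultimately have "X closure_of (s ` K) \<subseteq> {x \<in> topspace X. f x \<in> K}"
      by (intro closure_of_minimal)
    then show ?thesis by auto
  qed
  have "\<forall>\<mu>. \<exists>\<nu>. \<mu> \<in> Radon_prob Y \<longrightarrow> \<nu> \<in> Radon_prob X \<and>
      (\<forall>K. compactin Y K \<longrightarrow> measure \<mu> K \<le> measure \<nu> (X closure_of (s ` K)))"
  proof
    fix \<mu>
    have sX: "s y \<in> topspace X" if "y \<in> topspace Y" for y using s[OF that] Z(1) by blast
    show "\<exists>\<nu>. \<mu> \<in> Radon_prob Y \<longrightarrow> \<nu> \<in> Radon_prob X \<and>
      (\<forall>K. compactin Y K \<longrightarrow> measure \<mu> K \<le> measure \<nu> (X closure_of (s ` K)))"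
    proof (cases "\<mu> \<in> Radon_prob Y")
      case True
      obtain \<nu> where "\<nu> \<in> Radon_prob X"
        "\<And>K. compactin Y K \<Longrightarrow> measure \<mu> K \<le> measure \<nu> (X closure_of (s ` K))"
        by (rule Radon_lift_along_section[OF X HY True sX sK]) blast+
      then show ?thesis by blast
    qed simp
  qed
  then obtain S where S: "\<And>\<mu>. \<mu> \<in> Radon_prob Y \<Longrightarrow> S \<mu> \<in> Radon_prob X"
    "\<And>\<mu> K. \<mu> \<in> Radon_prob Y \<Longrightarrow> compactin Y K \<Longrightarrow> measure \<mu> K \<le> measure (S \<mu>) (X closure_of (s ` K))"
    by metis
  have fS: "Radon_map Y f (S \<mu>) = \<mu>" if \<mu>: "\<mu> \<in> Radon_prob Y" for \<mu>
  proof (rule sym, rule Radon_prob_eqI[OF HY \<mu> Radon_map_in_Radon_prob[OF HX HY f S(1)[OF \<mu>]]])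
    fix K assume K: "compactin Y K"
    interpret P: prob_space "S \<mu>" using Radon_probD[OF S(1)[OF \<mu>]] by simp
    have Km: "K \<in> sets (borel_of Y)" by (rule compactin_imp_borel_of[OF HY K])
    have "f -` K \<inter> topspace X \<in> sets (S \<mu>)"
      using measurable_sets[OF continuous_map_borel_measurable[OF f] Km] Radon_probD[OF S(1)[OF \<mu>]] by simp
    then have "measure (S \<mu>) (X closure_of (s ` K)) \<le> measure (S \<mu>) (f -` K \<inter> topspace X)"
      by (rule P.finite_measure_mono[OF fcl[OF K]])
    then show "measure \<mu> K \<le> measure (Radon_map Y f (S \<mu>)) K"
      using S(2)[OF \<mu> K] measure_Radon_map[OF f S(1)[OF \<mu>] Km] by simp
  qed
  obtain M :: "'b topology" and g where M: "metrizable_space M" and g: "continuous_map Y M g"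
    and ginj: "inj_on g (topspace Y)"
    using assms(3) unfolding submetrizable_space_def by (metis bij_betw_def)
  have HM: "Hausdorff_space M" using M by (rule metrizable_imp_Hausdorff_space)
  have pre: "precompact_in (Radon_topology X) (S ` Radon_prob Y \<inter> Radon_map Y f -` \<K>)"
    if \<K>: "precompact_in (Radon_topology Y) \<K>" for \<K>
  proof -
    have \<K>Y: "\<K> \<subseteq> Radon_prob Y" using \<K> by (simp add: precompact_in_def)
    \<comment> \<open>As \<open>S\<close> is a section of \<open>Radon_map Y f\<close>, the trace on its range of the preimage of
      \<open>\<K>\<close> is just the image of \<open>\<K>\<close> under \<open>S\<close>.\<close>
    have eq: "S ` Radon_prob Y \<inter> Radon_map Y f -` \<K> = S ` \<K>" using fS \<K>Y by force
    define C where "C = Radon_topology Y closure_of \<K>"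
    have C: "compactin (Radon_topology Y) C" using \<K> by (simp add: precompact_in_def C_def)
    have \<K>C: "\<K> \<subseteq> C" unfolding C_def using \<K>Y by (intro closure_of_subset) simp
    have CY: "C \<subseteq> Radon_prob Y" using compactin_subset_topspace[OF C] by simp
    obtain Q d where "Metric_space Q d" and RX: "Radon_topology X = Metric_space.mtopology Q d"
      using metrizable_space_Radon_topology[OF X] by (auto simp: metrizable_space_def)
    then interpret Metric_space Q d by simp
    have Q: "Q = Radon_prob X" using RX topspace_Radon_topology[of X] by simp
    have "compactin (Radon_topology X) (Radon_topology X closure_of (S ` \<K>))"
      unfolding RX
    proof (rule compactin_closure_of_if_subsequences)
      show "S ` \<K> \<subseteq> Q" using S(1) \<K>Y Q by auto
      fix \<tau> :: "nat \<Rightarrow> 'a measure" assume "range \<tau> \<subseteq> S ` \<K>"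
      then have "\<forall>n. \<exists>\<mu>. \<mu> \<in> \<K> \<and> \<tau> n = S \<mu>" by blast
      then obtain \<sigma> where \<sigma>: "\<And>n. \<sigma> n \<in> \<K>" "\<And>n. \<tau> n = S (\<sigma> n)" by metis
      have "inj_on (Radon_map M g) C"
        using inj_on_subset[OF inj_on_Radon_map[OF HY HM g ginj] CY] .
      moreover have "range \<sigma> \<subseteq> C" using \<sigma>(1) \<K>C by auto
      ultimately obtain r \<mu> where r: "strict_mono (r :: nat \<Rightarrow> nat)"
        and lim: "limitin (Radon_topology Y) (\<sigma> \<circ> r) \<mu> sequentially"
        using compactin_sequentially_if_injects_into_metrizable[OF C
            metrizable_space_Radon_topology[OF M] continuous_map_Radon_map[OF HY HM g]] by metis
      have \<sigma>Y: "\<sigma> n \<in> Radon_prob Y" for n using \<sigma>(1) \<K>Y by blast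
      then have "range (\<sigma> \<circ> r) \<subseteq> Radon_prob Y" by auto
      then have tight: "uniformly_tight Y (range (\<sigma> \<circ> r))"
        using assms(4) lim unfolding sequentially_Prohorov_space_def by blast
      have "uniformly_tight X (range (\<tau> \<circ> r))"
        unfolding uniformly_tight_def
      proof (intro allI impI)
        fix \<epsilon> :: real assume "\<epsilon> > 0"
        then obtain K where K: "compactin Y K" "\<And>n. measure (\<sigma> (r n)) (topspace Y - K) < \<epsilon>"
          using tight unfolding uniformly_tight_def by fastforce
        \<comment> \<open>The lifts inherit tightness from the measures below, with \<open>K\<close> replaced by the
          closure of \<open>s ` K\<close>.\<close>
        have "measure (\<tau> (r n)) (topspace X - X closure_of (s ` K)) < \<epsilon>" for n
        proof -
          define \<mu> where "\<mu> = \<sigma> (r n)"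
          have \<mu>: "\<mu> \<in> Radon_prob Y" using \<sigma>Y by (simp add: \<mu>_def)
          interpret P: prob_space \<mu> using Radon_probD[OF \<mu>] by simp
          interpret R: prob_space "S \<mu>" using Radon_probD[OF S(1)[OF \<mu>]] by simp
          have "measure (S \<mu>) (topspace X - X closure_of (s ` K)) = 1 - measure (S \<mu>) (X closure_of (s ` K))"
            using R.prob_compl[of "X closure_of (s ` K)"] Radon_probD[OF S(1)[OF \<mu>]]
              closedin_imp_borel_of[OF closedin_closure_of] by metis
          also have "\<dots> \<le> 1 - measure \<mu> K" using S(2)[OF \<mu> K(1)] by simp
          also have "\<dots> = measure \<mu> (topspace Y - K)"
            using P.prob_compl[of K] Radon_probD[OF \<mu>] compactin_imp_borel_of[OF HY K(1)] by simp
          also have "\<dots> < \<epsilon>" using K(2) by (simp add: \<mu>_def)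
          finally show ?thesis by (simp add: \<mu>_def \<sigma>(2))
        qed
        then show "\<exists>K. compactin X K \<and> (\<forall>\<mu>\<in>range (\<tau> \<circ> r). measure \<mu> (topspace X - K) < \<epsilon>)"
          using sK[OF K(1)] by (intro exI[of _ "X closure_of (s ` K)"]) auto
      qed
      moreover have "(\<tau> \<circ> r) n \<in> Radon_prob X" for n using S(1) \<sigma>Y \<sigma>(2) by simp
      ultimately obtain q \<nu> where "strict_mono (q :: nat \<Rightarrow> nat)"
        "limitin (Radon_topology X) (\<tau> \<circ> r \<circ> q) \<nu> sequentially"
        using uniformly_tight_imp_convergent_subsequence[OF X] by metis
      then show "\<exists>r l. strict_mono (r :: nat \<Rightarrow> nat) \<and> limitin mtopology (\<tau> \<circ> r) l sequentially"
        using r strict_mono_o unfolding RX o_assoc[symmetric] by blast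
    qed
    then show ?thesis
      unfolding precompact_in_def eq using S(1) \<K>Y by auto
  qed
  show ?thesis
    unfolding subproper_map_def
  proof (intro conjI exI[of _ "S ` Radon_prob Y"] allI impI)
    show "continuous_map (Radon_topology X) (Radon_topology Y) (Radon_map Y f)"
      by (rule continuous_map_Radon_map[OF HX HY f])
    show "S ` Radon_prob Y \<subseteq> topspace (Radon_topology X)" using S(1) by auto
    show "Radon_map Y f ` S ` Radon_prob Y = topspace (Radon_topology Y)"
      using fS by (force simp: image_image)
  qed (rule pre)
qed

end
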